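(* Let $\Sigma=\{0\}$ and let $\mathbf{G}$ be the graph whose vertex set $G$ is the set of all finite $1$-parameter words over $\Sigma$, in which two vertices $U,V$ with $|U|<|V|$ are adjacent if and only if (i) $V_{|U|}=\lambda_0$ and (ii) there is no $0\le j<|U|$ with $U_j=V_j=\lambda_0$ (there are no other edges). Then for every finite $k\geq 1$ and every colouring $\chi$ with finitely many colours of the induced subgraphs of $\mathbf{G}$ with $k$ vertices (equivalently, of the $k$-element subsets of $G$), there exists a graph embedding $f\colon\mathbf{G}\to\mathbf{G}$ such that the colour of every $k$-vertex induced subgraph $\mathbf{A}$ of $f(\mathbf{G})$ depends only on $\tau(f^{-1}[A])$; that is, for any two $k$-element subsets $A,A'$ of $f[G]$ with $\tau(f^{-1}[A])=\tau(f^{-1}[A'])$ we have $\chi(A)=\chi(A')$.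
   Context: A $k$-parameter word over a finite alphabet $\Sigma$ ($k\in\omega\cup\{\omega\}$) is a (finite or infinite) string $W$ over $\Sigma\cup\{\lambda_i:0\le i<k\}$ (new symbols called parameters) containing each $\lambda_i$, $0\le i<k$, such that for every $1\le j<k$ the first occurrence of $\lambda_j$ is after the first occurrence of $\lambda_{j-1}$. $|W|$ is the length of $W$ and $W_j$ its letter at index $j$ (indices start at $0$). If $W$ is an $n$-parameter word and $U$ a parameter word of length $m\le n$, $W(U)$ is obtained from $W$ by replacing each occurrence of $\lambda_i$, $0\le i<m$, by $U_i$ and truncating just before the first occurrence of $\lambda_m$ in $W$ (no truncation if $m=n$); $W(T)=\{W(U):U\in T\}$ for a set $T$. An envelope of a set $S$ of parameter words is a parameter word $W$ such that every $U\in S$ equals $W(U')$ for some parameter word $U'$; it is minimal if no envelope of $S$ has fewer parameters. For an envelope $W$ of $S$, $\tau_W(S)$ is the set $T$ of parameter words with $W(T)=S$. For a finite set $S$ of finite parameter words, $\tau(S)$ denotes $\tau_W(S)$ for any minimal envelope $W$ of $S$ (this does not depend on the choice of $W$). *)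

theory Defs
  imports "HOL-Library.Extended_Nat" "HOL-Library.Ramsey"
begin

text \<open>\<open>Par i\<close> is the parameter $\lambda_i$; being built by a separate constructor, it is never
  a symbol of the alphabet.\<close>

datatype 'a letter = Sym 'a | Par nat

datatype 'a pword = Fin "'a letter list" | Inf "nat \<Rightarrow> 'a letter"

fun wlength :: "'a pword \<Rightarrow> enat" where
  "wlength (Fin xs) = enat (length xs)"
| "wlength (Inf f) = \<infinity>"

text \<open>Only meaningful for indices below \<open>wlength\<close>.\<close>

fun wnth :: "'a pword \<Rightarrow> nat \<Rightarrow> 'a letter" where
  "wnth (Fin xs) j = xs ! j"
| "wnth (Inf f) j = f j"

definition build_word :: "enat \<Rightarrow> (nat \<Rightarrow> 'a letter) \<Rightarrow> 'a pword" where
  "build_word l f = (case l of enat n \<Rightarrow> Fin (map f [0..<n]) | \<infinity> \<Rightarrow> Inf f)"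

definition occurs :: "nat \<Rightarrow> 'a pword \<Rightarrow> bool" where
  "occurs i W \<longleftrightarrow> (\<exists>j. enat j < wlength W \<and> wnth W j = Par i)"

definition first_occ :: "nat \<Rightarrow> 'a pword \<Rightarrow> nat" where
  "first_occ i W = (LEAST j. enat j < wlength W \<and> wnth W j = Par i)"

text \<open>The number \<open>k\<close> of parameters ranges over $\omega\cup\{\omega\}$, with $\omega$ rendered as
  \<open>\<infinity>\<close>. A \<open>k\<close>-parameter word contains all of its \<open>k\<close> parameters.\<close>

definition param_word :: "'a set \<Rightarrow> enat \<Rightarrow> 'a pword \<Rightarrow> bool" where
  "param_word \<Sigma> k W \<longleftrightarrow>
     (\<forall>j. enat j < wlength W \<longrightarrow> wnth W j \<in> Sym ` \<Sigma> \<union> Par ` {i. enat i < k}) \<and>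
     (\<forall>i. enat i < k \<longrightarrow> occurs i W) \<and>
     (\<forall>j. 1 \<le> j \<and> enat j < k \<longrightarrow> first_occ (j - 1) W < first_occ j W)"

fun subst_letter :: "'a pword \<Rightarrow> 'a letter \<Rightarrow> 'a letter" where
  "subst_letter U (Sym a) = Sym a"
| "subst_letter U (Par i) = wnth U i"

text \<open>If \<open>W\<close> is an \<open>n\<close>-parameter word and \<open>U\<close> has length \<open>m \<le> n\<close>, then \<open>Par m\<close> occurs in \<open>W\<close>
  iff \<open>m < n\<close>, so the second and third alternatives below are the case \<open>m = n\<close>, in which nothing
  is truncated. The side condition \<open>m \<le> n\<close> is imposed where substitution is used.\<close>

definition subst_length :: "'a pword \<Rightarrow> 'a pword \<Rightarrow> enat" where
  "subst_length W U =
     (case wlength U of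
        enat m \<Rightarrow> if occurs m W then enat (first_occ m W) else wlength W
      | \<infinity> \<Rightarrow> wlength W)"

definition subst :: "'a pword \<Rightarrow> 'a pword \<Rightarrow> 'a pword" where
  "subst W U = build_word (subst_length W U) (\<lambda>j. subst_letter U (wnth W j))"

text \<open>The parameter words \<open>U\<close> for which \<open>W(U)\<close> is defined when \<open>W\<close> has \<open>n\<close> parameters.\<close>

definition substitutable :: "'a set \<Rightarrow> enat \<Rightarrow> 'a pword set" where
  "substitutable \<Sigma> n = {U. (\<exists>k. param_word \<Sigma> k U) \<and> wlength U \<le> n}"

text \<open>The number \<open>n\<close> of parameters of the envelope \<open>W\<close> is carried along as an argument.\<close>

definition envelope :: "'a set \<Rightarrow> 'a pword set \<Rightarrow> enat \<Rightarrow> 'a pword \<Rightarrow> bool" where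
  "envelope \<Sigma> S n W \<longleftrightarrow>
     param_word \<Sigma> n W \<and> (\<forall>U\<in>S. \<exists>U'\<in>substitutable \<Sigma> n. U = subst W U')"

definition minimal_envelope :: "'a set \<Rightarrow> 'a pword set \<Rightarrow> enat \<Rightarrow> 'a pword \<Rightarrow> bool" where
  "minimal_envelope \<Sigma> S n W \<longleftrightarrow>
     envelope \<Sigma> S n W \<and> \<not> (\<exists>n' W'. envelope \<Sigma> S n' W' \<and> n' < n)"

definition envelope_type :: "'a set \<Rightarrow> enat \<Rightarrow> 'a pword \<Rightarrow> 'a pword set \<Rightarrow> 'a pword set" where
  "envelope_type \<Sigma> n W S = (THE T. T \<subseteq> substitutable \<Sigma> n \<and> subst W ` T = S)"

text \<open>For finite sets \<open>S\<close> of finite parameter words, the type does not depend on the minimal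
  envelope chosen.\<close>

definition embedding_type :: "'a set \<Rightarrow> 'a pword set \<Rightarrow> 'a pword set" where
  "embedding_type \<Sigma> S =
     (SOME T. \<exists>n W. minimal_envelope \<Sigma> S n W \<and> T = envelope_type \<Sigma> n W S)"

text \<open>Graphs are given by a vertex set and an adjacency relation. Embeddings are embeddings of
  structures: they preserve both edges and non-edges.\<close>

definition graph_embedding ::
    "'v set \<Rightarrow> ('v \<Rightarrow> 'v \<Rightarrow> bool) \<Rightarrow> 'w set \<Rightarrow> ('w \<Rightarrow> 'w \<Rightarrow> bool) \<Rightarrow> ('v \<Rightarrow> 'w) \<Rightarrow> bool" where
  "graph_embedding V E V' E' f \<longleftrightarrow>
     f ` V \<subseteq> V' \<and> inj_on f V \<and> (\<forall>x\<in>V. \<forall>y\<in>V. E x y \<longleftrightarrow> E' (f x) (f y))"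

definition G_verts :: "nat pword set" where
  "G_verts = {U. param_word {0} 1 U \<and> wlength U \<noteq> \<infinity>}"

definition G_edge_up :: "nat pword \<Rightarrow> nat pword \<Rightarrow> bool" where
  "G_edge_up U V \<longleftrightarrow>
     (\<exists>u v. U = Fin u \<and> V = Fin v \<and> length u < length v \<and> v ! length u = Par 0 \<and>
        \<not> (\<exists>j<length u. u ! j = Par 0 \<and> v ! j = Par 0))"

definition G_adj :: "nat pword \<Rightarrow> nat pword \<Rightarrow> bool" where
  "G_adj U V \<longleftrightarrow>
     U \<in> G_verts \<and> V \<in> G_verts \<and> (G_edge_up U V \<or> G_edge_up V U)"

end

theory Submission
  imports Defs "HOL-Analysis.T1_Spaces"
begin

text \<open>For an infinite-parameter word \<open>W\<close> the map \<open>U \<mapsto> W(U)\<close> is an embedding of the graph into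
  itself, because \<open>W(U)\<close> has a letter \<open>U\<^sub>i\<close> at every occurrence of \<open>\<lambda>\<^sub>i\<close> in \<open>W\<close> and ends where
  \<open>\<lambda>\<close> with index \<open>|U|\<close> first occurs. A \<open>k\<close>-element set of vertices is \<open>Q(T)\<close> for a minimal envelope
  \<open>Q\<close> and its type \<open>T\<close>, where \<open>Q\<close> is a finite word with \<open>n \<le> 3\<^sup>k\<close> parameters and \<open>n\<close> is the largest
  length in \<open>T\<close>; its image under the embedding is \<open>(W(Q))(T)\<close>. So it suffices that the finite
  colouring \<open>Q \<mapsto> (T \<mapsto> \<chi>(Q(T)))\<close> is constant on the words \<open>W(Q)\<close>, for every \<open>n \<le> 3\<^sup>k\<close>: the
  Ramsey theorem for finite \<open>n\<close>-parameter words.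

  That theorem follows by fusion and induction on \<open>n\<close> from the Carlson-Simpson theorem, which is
  obtained from an ultrafilter \<open>q\<close> on the words containing a variable \<open>x\<close> such that substituting any
  letter for \<open>x\<close> in \<open>q\<close> gives an ultrafilter \<open>p\<close> with \<open>p q = q\<close>. One takes \<open>p\<close> to be a minimal idempotent
  on the variable-free words and \<open>q \<le> p\<close> an idempotent.\<close>

section \<open>Idempotents in compact right topological semigroups\<close>

text \<open>Zorn's lemma is applied to the complements of the nonempty closed sets with
  \<open>P\<close>. A chain of such sets has nonempty intersection by compactness, and
  \<open>inter\<close> preserves \<open>P\<close>.\<close>

lemma minimal_closed_subset:
  fixes K :: "'x::topological_space set"
  assumes K: "compact K" "closed K" "K \<noteq> {}" "P K"
    and inter: "\<And>\<C>. \<C> \<noteq> {} \<Longrightarrow> (\<And>A. A \<in> \<C> \<Longrightarrow> A \<subseteq> K \<and> P A) \<Longrightarrow> P (\<Inter>\<C>)"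
  obtains M where "M \<subseteq> K" "closed M" "M \<noteq> {}" "P M"
    "\<And>A. A \<subseteq> M \<Longrightarrow> closed A \<Longrightarrow> A \<noteq> {} \<Longrightarrow> P A \<Longrightarrow> A = M"
proof -
  define \<A> where "\<A> = {A. A \<subseteq> K \<and> closed A \<and> A \<noteq> {} \<and> P A}"
  have "\<exists>M\<in>uminus ` \<A>. \<forall>X\<in>uminus ` \<A>. M \<subseteq> X \<longrightarrow> X = M"
  proof (rule subset_Zorn_nonempty)
    show "uminus ` \<A> \<noteq> {}"
      using K by (auto simp: \<A>_def)
    fix \<B> assume ne: "\<B> \<noteq> {}" and ch: "subset.chain (uminus ` \<A>) \<B>"
    define \<C> where "\<C> = uminus ` \<B>"
    have C: "\<C> \<noteq> {}" "\<C> \<subseteq> \<A>" "\<Union>\<B> = - \<Inter>\<C>"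
      using ne ch by (auto simp: \<C>_def subset.chain_def)
    have lin: "A \<subseteq> B \<or> B \<subseteq> A" if "A \<in> \<C>" "B \<in> \<C>" for A B
      using that ch unfolding \<C>_def subset.chain_def by fastforce
    \<comment> \<open>A finite chain has its intersection as least member, which gives the finite
      intersection property.\<close>
    have fin: "\<Inter>F \<in> F" if "finite F" "F \<noteq> {}" "F \<subseteq> \<C>" for F
      using that
    proof (induction F rule: finite_ne_induct)
      case (insert A F)
      then have "\<Inter>F \<in> F" by auto
      then have "A \<subseteq> \<Inter>F \<or> \<Inter>F \<subseteq> A" using lin insert by blast
      then have "A \<inter> \<Inter>F = A \<or> A \<inter> \<Inter>F = \<Inter>F" by blast
      then show ?case using \<open>\<Inter>F \<in> F\<close> by auto
    qed auto
    have "K \<inter> \<Inter>\<C> \<noteq> {}"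
    proof (rule compact_imp_fip)
      show "compact K" by fact
      show "closed T" if "T \<in> \<C>" for T using that C by (auto simp: \<A>_def)
      show "K \<inter> \<Inter>F \<noteq> {}" if "finite F" "F \<subseteq> \<C>" for F
      proof (cases "F = {}")
        case False
        then have "\<Inter>F \<in> \<A>" using fin[of F] that C by auto
        then show ?thesis by (auto simp: \<A>_def)
      qed (use K in auto)
    qed
    moreover have "P (\<Inter>\<C>)" using C by (intro inter) (auto simp: \<A>_def)
    moreover have "closed (\<Inter>\<C>)" using C by (intro closed_Inter) (auto simp: \<A>_def)
    moreover have "\<Inter>\<C> \<subseteq> K" using C by (auto simp: \<A>_def)
    ultimately have "\<Inter>\<C> \<in> \<A>" by (auto simp: \<A>_def)
    then show "\<Union>\<B> \<in> uminus ` \<A>" using C by blast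
  qed
  then obtain M where M: "M \<in> \<A>" "\<And>X. X \<in> \<A> \<Longrightarrow> - M \<subseteq> - X \<Longrightarrow> - X = - M"
    by auto
  show ?thesis
  proof
    show "M \<subseteq> K" "closed M" "M \<noteq> {}" "P M" using M(1) by (auto simp: \<A>_def)
    fix A assume "A \<subseteq> M" "closed A" "A \<noteq> {}" "P A"
    then show "A = M" using M(2)[of A] M(1) by (auto simp: \<A>_def)
  qed
qed

text \<open>Continuity is asked for in the left factor only. \<open>compact_closed\<close> stands in
  for the Hausdorff axiom: it makes compact translates and singletons closed.\<close>

locale right_topological_semigroup =
  fixes mult :: "'x::topological_space \<Rightarrow> 'x \<Rightarrow> 'x"  (infixl \<open>\<star>\<close> 70)
  assumes assoc: "(p \<star> q) \<star> r = p \<star> (q \<star> r)"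
    and cont: "continuous_on UNIV (\<lambda>p. p \<star> q)"
    and compact_closed: "compact (S :: 'x set) \<Longrightarrow> closed S"
begin

lemma compact_translate:
  assumes "compact M" shows "compact ((\<lambda>p. p \<star> q) ` M)"
  by (rule compact_continuous_image[OF continuous_on_subset[OF cont] assms]) simp

text \<open>Let \<open>M\<close> be a minimal closed subsemigroup and \<open>e\<close> an element.
  The translate of \<open>M\<close> by \<open>e\<close> is again such a subsemigroup, hence all of
  \<open>M\<close>, so \<open>p \<star> e = e\<close> has a solution in \<open>M\<close>. The
  solutions form a closed subsemigroup, hence all of \<open>M\<close>, so \<open>e\<close> itself is
  one.\<close>

lemma Ellis:
  assumes "compact K" "K \<noteq> {}" and "\<And>p q. p \<in> K \<Longrightarrow> q \<in> K \<Longrightarrow> p \<star> q \<in> K"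
  obtains e where "e \<in> K" "e \<star> e = e"
proof -
  let ?P = "\<lambda>M. \<forall>p\<in>M. \<forall>q\<in>M. p \<star> q \<in> M"
  have closed: "closed K" and P: "?P K" using assms compact_closed by auto
  have inter: "?P (\<Inter>\<C>)" if "\<C> \<noteq> {}" "\<And>A. A \<in> \<C> \<Longrightarrow> A \<subseteq> K \<and> ?P A" for \<C>
    by (intro ballI InterI) (metis that(2) Inter_iff)
  obtain M where M: "M \<subseteq> K" "closed M" "M \<noteq> {}" "?P M"
    and min: "\<And>A. A \<subseteq> M \<Longrightarrow> closed A \<Longrightarrow> A \<noteq> {} \<Longrightarrow> ?P A \<Longrightarrow> A = M"
  proof (rule minimal_closed_subset[of K ?P])
    show "compact K" "closed K" "K \<noteq> {}" "?P K" by fact+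
    show "?P (\<Inter>\<C>)" if "\<C> \<noteq> {}" "\<And>A. A \<in> \<C> \<Longrightarrow> A \<subseteq> K \<and> ?P A" for \<C>
      using that by (rule inter)
  qed (rule that)
  have cM: "compact M" using M(1,2) assms(1) by (metis compact_Int_closed inf.absorb2)
  obtain e where e: "e \<in> M" using M(3) by auto
  have "(\<lambda>p. p \<star> e) ` M = M"
  proof (rule min)
    show "(\<lambda>p. p \<star> e) ` M \<subseteq> M" using M(4) e by auto
    show "closed ((\<lambda>p. p \<star> e) ` M)" using cM compact_translate compact_closed by blast
    show "(\<lambda>p. p \<star> e) ` M \<noteq> {}" using M(3) by auto
    show "\<forall>p\<in>(\<lambda>p. p \<star> e) ` M. \<forall>q\<in>(\<lambda>p. p \<star> e) ` M. p \<star> q \<in> (\<lambda>p. p \<star> e) ` M"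
    proof safe
      fix p q assume "p \<in> M" "q \<in> M"
      then have "(p \<star> e) \<star> (q \<star> e) = (p \<star> e \<star> q) \<star> e" "p \<star> e \<star> q \<in> M"
        using M(4) e by (auto simp: assoc)
      then show "p \<star> e \<star> (q \<star> e) \<in> (\<lambda>p. p \<star> e) ` M" by auto
    qed
  qed
  then obtain p where p: "p \<in> M" "p \<star> e = e" using e by (metis imageE)
  define N where "N = M \<inter> (\<lambda>p. p \<star> e) -` {e}"
  have "N = M"
  proof (rule min)
    have "closed ((\<lambda>p. p \<star> e) -` {e})"
      using cont compact_closed[of "{e}"] by (simp add: closed_vimage)
    then show "closed N" using M(2) by (auto simp: N_def)
    show "\<forall>p\<in>N. \<forall>q\<in>N. p \<star> q \<in> N" using M(4) by (auto simp: N_def assoc)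
  qed (use p in \<open>auto simp: N_def\<close>)
  then have "e \<star> e = e" using e by (auto simp: N_def)
  then show ?thesis using that e M(1) by auto
qed

text \<open>\<open>p\<close> is an idempotent in a minimal closed left ideal \<open>L\<close>. If
  \<open>e\<close> is an idempotent below \<open>p\<close>, then \<open>e = e \<star> p\<close> lies
  in \<open>L\<close>, and minimality makes the translate of \<open>L\<close> by \<open>e\<close>
  equal to \<open>L\<close>. So \<open>p = x \<star> e\<close> for some \<open>x\<close>, whence
  \<open>p = p \<star> e = e\<close>.\<close>

lemma minimal_idempotent:
  assumes K: "compact K" "K \<noteq> {}" "\<And>p q. p \<in> K \<Longrightarrow> q \<in> K \<Longrightarrow> p \<star> q \<in> K"
  obtains p where "p \<in> K" "p \<star> p = p"
    "\<And>e. e \<in> K \<Longrightarrow> e \<star> e = e \<Longrightarrow> e \<star> p = e \<Longrightarrow> p \<star> e = e \<Longrightarrow> e = p"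
proof -
  let ?P = "\<lambda>L. \<forall>p\<in>K. \<forall>q\<in>L. p \<star> q \<in> L"
  have closed: "closed K" and P: "?P K" using assms compact_closed by auto
  have inter: "?P (\<Inter>\<C>)" if "\<C> \<noteq> {}" "\<And>A. A \<in> \<C> \<Longrightarrow> A \<subseteq> K \<and> ?P A" for \<C>
    by (intro ballI InterI) (metis that(2) Inter_iff)
  obtain L where L: "L \<subseteq> K" "closed L" "L \<noteq> {}" "?P L"
    and min: "\<And>A. A \<subseteq> L \<Longrightarrow> closed A \<Longrightarrow> A \<noteq> {} \<Longrightarrow> ?P A \<Longrightarrow> A = L"
  proof (rule minimal_closed_subset[of K ?P])
    show "compact K" "closed K" "K \<noteq> {}" "?P K" by fact+
    show "?P (\<Inter>\<C>)" if "\<C> \<noteq> {}" "\<And>A. A \<in> \<C> \<Longrightarrow> A \<subseteq> K \<and> ?P A" for \<C>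
      using that by (rule inter)
  qed (rule that)
  have cL: "compact L" using L(1,2) K(1) by (metis compact_Int_closed inf.absorb2)
  obtain p where p: "p \<in> L" "p \<star> p = p"
    using Ellis[of L] cL L by blast
  show ?thesis
  proof
    show "p \<in> K" "p \<star> p = p" using p L by auto
    fix e assume e: "e \<in> K" "e \<star> e = e" "e \<star> p = e" "p \<star> e = e"
    then have eL: "e \<in> L" using L(4) p by metis
    have "(\<lambda>p. p \<star> e) ` L = L"
    proof (rule min)
      show "(\<lambda>p. p \<star> e) ` L \<subseteq> L" using L eL by auto
      show "closed ((\<lambda>p. p \<star> e) ` L)" using cL compact_translate compact_closed by blast
      show "\<forall>p\<in>K. \<forall>q\<in>(\<lambda>p. p \<star> e) ` L. p \<star> q \<in> (\<lambda>p. p \<star> e) ` L"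
        using L(4) by (auto simp: assoc[symmetric])
    qed (use L in auto)
    then obtain x where "p = x \<star> e" using p by (metis imageE)
    then show "e = p" using e by (metis assoc)
  qed
qed

end

section \<open>Ultrafilters on words\<close>

text \<open>Ultrafilters are represented by their characteristic functions, so that the Stone topology is
  the product topology.\<close>

definition ultra :: "('a set \<Rightarrow> bool) \<Rightarrow> bool" where
  "ultra p \<longleftrightarrow> (\<forall>A B. p (A \<inter> B) \<longleftrightarrow> p A \<and> p B) \<and> (\<forall>A. p (- A) \<longleftrightarrow> \<not> p A)"

text \<open>The extension of concatenation to ultrafilters. For fixed \<open>q\<close> each
  coordinate of \<open>conv p q\<close> is a coordinate of \<open>p\<close>, hence the continuity in
  \<open>p\<close>.\<close>

definition conv :: "('a list set \<Rightarrow> bool) \<Rightarrow> ('a list set \<Rightarrow> bool) \<Rightarrow> 'a list set \<Rightarrow> bool" where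
  "conv p q = (\<lambda>B. p {u. q {v. u @ v \<in> B}})"

section \<open>The Stone topology: compactness and continuity of the product\<close>

lemma compact_bool_fun: "compact (UNIV :: ('a \<Rightarrow> bool) set)"
proof -
  have "compact_space (product_topology (\<lambda>_. euclidean) UNIV :: ('a \<Rightarrow> bool) topology)"
    unfolding compact_space_product_topology
    by (simp add: compact_space_def compactin_euclidean_iff finite_imp_compact)
  then show ?thesis
    by (simp add: compact_space_def euclidean_product_topology)
qed

lemma compact_closed_bool_fun:
  assumes "compact (S :: ('a \<Rightarrow> bool) set)" shows "closed S"
proof -
  have "Hausdorff_space (euclidean :: bool topology)"
    unfolding Hausdorff_space_def disjnt_def open_openin[symmetric] by (intro allI impI hausdorff) simp
  then have "Hausdorff_space (product_topology (\<lambda>_. euclidean) UNIV :: ('a \<Rightarrow> bool) topology)"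
    unfolding Hausdorff_space_product_topology by simp
  then have "Hausdorff_space (euclidean :: ('a \<Rightarrow> bool) topology)"
    unfolding euclidean_product_topology .
  then have "closedin euclidean S"
    using assms by (intro compactin_imp_closedin) simp_all
  then show ?thesis by simp
qed

interpretation conv: right_topological_semigroup "conv :: ('a list set \<Rightarrow> bool) \<Rightarrow> _"
proof
  fix p q r :: "'a list set \<Rightarrow> bool"
  show "conv (conv p q) r = conv p (conv q r)" by (simp add: conv_def)
  show "continuous_on UNIV (\<lambda>p. conv p q)"
    unfolding conv_def
    by (rule continuous_on_coordinatewise_then_product, rule continuous_on_product_coordinates)
qed (rule compact_closed_bool_fun)

lemma closed_coordinate: "closed {p :: 'a \<Rightarrow> bool. p A}"
  using closed_vimage[of "{True}" "\<lambda>p :: 'a \<Rightarrow> bool. p A"] by (simp add: vimage_def closed_def open_discrete)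

lemma closed_coordinate_not: "closed {p :: 'a \<Rightarrow> bool. \<not> p A}"
  using closed_vimage[of "{False}" "\<lambda>p :: 'a \<Rightarrow> bool. p A"] by (simp add: vimage_def closed_def open_discrete)

text \<open>Every instance of the conditions in \<open>ultra\<close> is a Boolean combination of
  finitely many coordinates, so the set is an intersection of closed sets in a compact
  space.\<close>

lemma compact_ultra: "compact {p. ultra p \<and> p V}"
proof -
  have eq: "(a \<longleftrightarrow> b) \<longleftrightarrow> (\<not> a \<or> b) \<and> (\<not> b \<or> a)" for a b by blast
  have "closed {p :: 'a set \<Rightarrow> bool. ultra p}"
    unfolding ultra_def eq de_Morgan_conj not_not Collect_conj_eq Collect_disj_eq Collect_all_eq
    by (intro closed_Int closed_INT ballI closed_Un closed_coordinate closed_coordinate_not)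
  then have "closed {p. ultra p \<and> p V}"
    unfolding Collect_conj_eq by (intro closed_Int closed_coordinate)
  then show ?thesis
    using compact_Int_closed[OF compact_bool_fun, of "{p. ultra p \<and> p V}"] by simp
qed

section \<open>Calculus of ultrafilters\<close>

lemma ultra_Int: "ultra p \<Longrightarrow> p (A \<inter> B) \<longleftrightarrow> p A \<and> p B"
  unfolding ultra_def by blast

lemma ultra_Compl: "ultra p \<Longrightarrow> p (- A) \<longleftrightarrow> \<not> p A"
  unfolding ultra_def by blast

lemma ultraI:
  "(\<And>A B. p (A \<inter> B) \<longleftrightarrow> p A \<and> p B) \<Longrightarrow> (\<And>A. p (- A) \<longleftrightarrow> \<not> p A) \<Longrightarrow> ultra p"
  unfolding ultra_def by blast

lemma ultra_mono:
  assumes "ultra p" "p A" "A \<subseteq> B" shows "p B"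
  using ultra_Int[OF assms(1), of A B] assms(2,3) by (simp add: inf.absorb1)

lemma ultra_not_empty:
  assumes "ultra p" shows "\<not> p {}"
  using ultra_Int[OF assms, of "{}" UNIV] ultra_Compl[OF assms, of UNIV] by simp

lemma ultra_UNIV:
  assumes "ultra p" shows "p UNIV"
  using ultra_not_empty[OF assms] ultra_Compl[OF assms, of UNIV] by simp

lemma ultra_Inter:
  assumes "ultra p" "finite F" "\<And>A. A \<in> F \<Longrightarrow> p A"
  shows "p (\<Inter>F)"
  using assms(2,3)
proof (induction F rule: finite_induct)
  case empty then show ?case using ultra_UNIV[OF assms(1)] by simp
next
  case (insert A F) then show ?case by (simp add: ultra_Int[OF assms(1)])
qed

lemma ultra_Union:
  assumes "ultra p" "finite F" "p (\<Union>F)"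
  obtains A where "A \<in> F" "p A"
proof (rule ccontr)
  assume "\<not> thesis"
  then have "p (- A)" if "A \<in> F" for A
    using ultra_Compl[OF assms(1)] that \<open>\<And>A. A \<in> F \<Longrightarrow> p A \<Longrightarrow> thesis\<close> by blast
  then have "p (\<Inter>(uminus ` F))"
    by (intro ultra_Inter[OF assms(1)]) (auto simp: assms(2))
  moreover have "\<Inter>(uminus ` F) = - \<Union>F" by auto
  ultimately show False using ultra_Compl[OF assms(1), of "\<Union>F"] assms(3) by simp
qed

lemma ultra_cong:
  assumes "ultra p" "p S" "A \<inter> S = B \<inter> S"
  shows "p A = p B"
  using ultra_Int[OF assms(1), of A S] ultra_Int[OF assms(1), of B S] assms(2,3) by simp

lemma ultra_principal: "ultra (\<lambda>A. a \<in> A)"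
  by (rule ultraI) simp_all

lemma ultra_image: "ultra p \<Longrightarrow> ultra (\<lambda>B. p (h -` B))"
  by (rule ultraI) (simp_all add: vimage_Compl ultra_Int ultra_Compl)

lemma ultra_conv:
  assumes "ultra p" "ultra q" shows "ultra (conv p q)"
proof (rule ultraI)
  show "conv p q (A \<inter> B) \<longleftrightarrow> conv p q A \<and> conv p q B" for A B
  proof -
    have "{v. u @ v \<in> A \<inter> B} = {v. u @ v \<in> A} \<inter> {v. u @ v \<in> B}" for u by auto
    then have "{u. q {v. u @ v \<in> A \<inter> B}} = {u. q {v. u @ v \<in> A}} \<inter> {u. q {v. u @ v \<in> B}}"
      by (simp only: ultra_Int[OF assms(2)] Collect_conj_eq)
    then show ?thesis by (simp only: conv_def ultra_Int[OF assms(1)])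
  qed
  show "conv p q (- A) \<longleftrightarrow> \<not> conv p q A" for A
  proof -
    have "{v. u @ v \<in> - A} = - {v. u @ v \<in> A}" for u by auto
    then have "{u. q {v. u @ v \<in> - A}} = - {u. q {v. u @ v \<in> A}}"
      by (simp only: ultra_Compl[OF assms(2)] Collect_neg_eq)
    then show ?thesis by (simp only: conv_def ultra_Compl[OF assms(1)])
  qed
qed

lemma conv_concentrated:
  assumes "ultra p" "ultra q" "p A" "q B" "\<And>u v. u \<in> A \<Longrightarrow> v \<in> B \<Longrightarrow> u @ v \<in> C"
  shows "conv p q C"
  unfolding conv_def
proof (rule ultra_mono[OF assms(1,3)])
  show "A \<subseteq> {u. q {v. u @ v \<in> C}}"
  proof
    fix u assume "u \<in> A"
    then have "B \<subseteq> {v. u @ v \<in> C}" using assms(5) by auto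
    then show "u \<in> {u. q {v. u @ v \<in> C}}" using ultra_mono[OF assms(2,4)] by simp
  qed
qed

section \<open>Variable words and an ultrafilter stable under instantiation\<close>

definition instantiate :: "'a \<Rightarrow> 'a \<Rightarrow> 'a list \<Rightarrow> 'a list" where
  "instantiate x a = map (\<lambda>b. if b = x then a else b)"

definition variable_words :: "'a set \<Rightarrow> 'a \<Rightarrow> 'a list set" where
  "variable_words A x = {w. set w \<subseteq> insert x A \<and> x \<in> set w}"

lemma instantiate_append: "instantiate x a (u @ v) = instantiate x a u @ instantiate x a v"
  by (simp add: instantiate_def)

text \<open>The two nested occurrences of \<open>q\<close> say that \<open>B\<close> belongs to \<open>conv (h q) q\<close>, where \<open>h\<close> is the
  extension of \<open>instantiate x a\<close> to ultrafilters.\<close>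

lemma variable_word_ultrafilter:
  assumes "x \<notin> A"
  obtains q where "ultra q" "q (variable_words A x)"
    "\<And>a B. a \<in> A \<Longrightarrow> q {u. q {v. instantiate x a u @ v \<in> B}} \<longleftrightarrow> q B"
proof -
  define V where "V = variable_words A x"
  define S where "S = lists A"
  let ?K = "\<lambda>S :: 'a list set. {p. ultra p \<and> p S}"
  have VS: "u @ v \<in> V" if "u \<in> V" "v \<in> S" for u v
    using that by (auto simp: V_def S_def variable_words_def)
  have SV: "u @ v \<in> V" if "u \<in> S" "v \<in> V" for u v
    using that by (auto simp: V_def S_def variable_words_def)
  have VV: "u @ v \<in> V" if "u \<in> V" "v \<in> V" for u v
    using that by (auto simp: V_def variable_words_def)
  have SS: "u @ v \<in> S" if "u \<in> S" "v \<in> S" for u v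
    using that by (auto simp: S_def)
  have KS: "?K S \<noteq> {}" using ultra_principal[of "[]"] by (auto simp: S_def)
  obtain p where "p \<in> ?K S" "conv p p = p"
    and pmin: "\<And>e. e \<in> ?K S \<Longrightarrow> conv e e = e \<Longrightarrow> conv e p = e \<Longrightarrow> conv p e = e \<Longrightarrow> e = p"
  proof (rule conv.minimal_idempotent[of "?K S"])
    show "conv p q \<in> ?K S" if "p \<in> ?K S" "q \<in> ?K S" for p q
      using that ultra_conv conv_concentrated[OF _ _ _ _ SS] by auto
    show "?K S \<noteq> {}" by fact
    show "compact (?K S)" by (rule compact_ultra)
  qed (rule that)
  then have p: "ultra p" "p S" "conv p p = p" by auto
  \<comment> \<open>All elements \<open>r\<close> of this compact subsemigroup satisfy
    \<open>conv r p = r\<close>, since \<open>p\<close> is idempotent.\<close>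
  let ?M = "(\<lambda>v. conv v p) ` ?K V"
  have M: "?M \<subseteq> ?K V"
    using p ultra_conv conv_concentrated[OF _ _ _ _ VS] by auto
  have "[x] \<in> V" by (simp add: V_def variable_words_def)
  then have "?K V \<noteq> {}" using ultra_principal[of "[x]"] by blast
  have mult: "conv r r' \<in> ?M" if rM: "r \<in> ?M" "r' \<in> ?M" for r r'
  proof -
    obtain v' where v': "v' \<in> ?K V" "r' = conv v' p" using rM by auto
    have "conv r v' \<in> ?K V"
      using rM M v' ultra_conv conv_concentrated[OF _ _ _ _ VV] by auto
    then show ?thesis using v' by (simp add: conv.assoc[symmetric] image_iff) metis
  qed
  obtain r where r: "r \<in> ?M" "conv r r = r"
    by (rule conv.Ellis[of ?M])
      (use mult \<open>?K V \<noteq> {}\<close> conv.compact_translate[OF compact_ultra] in auto)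
  have rp: "conv r p = r" using r(1) p(3) by (auto simp: conv.assoc)
  have rV: "ultra r" "r V" using r(1) M by auto
  \<comment> \<open>Multiplying the idempotent \<open>r\<close> by \<open>p\<close> on the left also
    gives \<open>conv p q = q\<close>. So \<open>q\<close> is an idempotent below \<open>p\<close>
    that still lives on variable words.\<close>
  define q where "q = conv p r"
  have q: "ultra q" "q V"
    using p rV ultra_conv conv_concentrated[OF _ _ _ _ SV] by (auto simp: q_def)
  have qp: "conv q p = q" by (simp add: q_def conv.assoc rp)
  have pq: "conv p q = q" by (simp add: q_def conv.assoc[symmetric] p)
  have qq: "conv q q = q" by (metis conv.assoc q_def qp r(2) rp)
  show ?thesis
  proof
    show "ultra q" "q (variable_words A x)" using q by (auto simp: V_def)
    fix a B assume a: "a \<in> A"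
    define h where "h p = (\<lambda>B. p (instantiate x a -` B))" for p :: "'a list set \<Rightarrow> bool"
    have hom: "h (conv s t) = conv (h s) (h t)" for s t
      by (simp add: h_def conv_def instantiate_append vimage_def)
    have hp: "h p = p"
    proof
      fix B
      have "instantiate x a u = u" if "u \<in> S" for u
        unfolding instantiate_def using that assms by (intro map_idI) (auto simp: S_def)
      then show "h p B = p B"
        unfolding h_def by (intro ultra_cong[OF p(1,2)]) auto
    qed
    \<comment> \<open>\<open>h\<close> is a homomorphism that fixes \<open>p\<close>, so it sends
      \<open>q\<close> to an idempotent below \<open>p\<close> on variable-free words. Minimality of
      \<open>p\<close> forces equality.\<close>
    have "h q = p"
    proof (rule pmin)
      have "ultra (h q)" unfolding h_def by (intro ultra_image q)
      moreover have "V \<subseteq> instantiate x a -` S"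
        using a by (fastforce simp: V_def S_def variable_words_def instantiate_def)
      then have "h q S" unfolding h_def using ultra_mono q by blast
      ultimately show "h q \<in> ?K S" by simp
    qed (use hom hp qq qp pq in metis)+
    then have "conv (h q) q = q" using pq by simp
    then have "conv (h q) q B = q B" by simp
    then show "q {u. q {v. instantiate x a u @ v \<in> B}} \<longleftrightarrow> q B"
      by (simp add: conv_def h_def vimage_def)
  qed
qed

section \<open>The Carlson-Simpson theorem\<close>

lemma variable_words_instantiate:
  "w \<in> variable_words A x \<Longrightarrow> a \<in> A \<Longrightarrow> set (instantiate x a w) \<subseteq> A"
  by (auto simp: variable_words_def instantiate_def)

text \<open>Colouring a variable word by the colour of its part before the first \<open>x\<close> is what yields
  words truncated just before the next parameter.\<close>

theorem Carlson_Simpson: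
  assumes A: "finite A" "x \<notin> A" and c: "finite (c ` lists A)"
  shows "\<exists>w c0. (\<forall>j. w j \<in> variable_words A x) \<and>
    (\<forall>v\<in>lists A. c (concat (map (\<lambda>i. instantiate x (v ! i) (w i)) [0..<length v]) @
      takeWhile (\<lambda>b. b \<noteq> x) (w (length v))) = c0)"
proof -
  define V where "V = variable_words A x"
  define pre where "pre = takeWhile (\<lambda>b :: 'a. b \<noteq> x)"
  obtain q where q: "ultra q" "q V"
    and instantiate: "\<And>a B. a \<in> A \<Longrightarrow> q {u. q {v. instantiate x a u @ v \<in> B}} \<longleftrightarrow> q B"
    using variable_word_ultrafilter[OF A(2)] unfolding V_def by metis
  have "V \<subseteq> \<Union>((\<lambda>d. {u \<in> V. c (pre u) = d}) ` c ` lists A)"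
  proof
    fix u assume u: "u \<in> V"
    then have "pre u \<in> lists A"
      by (auto simp: V_def variable_words_def pre_def dest!: set_takeWhileD)
    then show "u \<in> \<Union>((\<lambda>d. {u \<in> V. c (pre u) = d}) ` c ` lists A)" using u by blast
  qed
  then have "q (\<Union>((\<lambda>d. {u \<in> V. c (pre u) = d}) ` c ` lists A))"
    using q ultra_mono by blast
  then obtain c0 where c0: "q {u \<in> V. c (pre u) = c0}"
    by (rule ultra_Union[OF q(1) finite_imageI[OF c]]) auto
  define C where "C = {u \<in> V. c (pre u) = c0}"
  \<comment> \<open>The words \<open>u\<close> that \<open>q\<close>-almost every continuation
    brings into the colour class \<open>C\<close>.\<close>
  define C' where "C' = {u. q {v. u @ v \<in> C}}"
  \<comment> \<open>For \<open>u\<close> in \<open>C'\<close>, \<open>q\<close>-almost every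
    \<open>w\<close> has \<open>u @ w\<close> in \<open>C\<close>. By the stability of
    \<open>q\<close> under instantiation, \<open>q\<close>-almost every \<open>w\<close> also has
    \<open>u @ instantiate x a w\<close> in \<open>C'\<close>. As \<open>D\<close> and
    \<open>A\<close> are finite, one \<open>w\<close> serves all of them.\<close>
  have ext: "\<exists>w\<in>V. \<forall>u\<in>D. u @ w \<in> C \<and> (\<forall>a\<in>A. u @ instantiate x a w \<in> C')" if D: "finite D" "D \<subseteq> C'" for D
  proof -
    define \<F> where "\<F> = insert V ((\<lambda>u. {w. u @ w \<in> C}) ` D \<union> (\<lambda>(u, a). {w. u @ instantiate x a w \<in> C'}) ` (D \<times> A))"
    have "q {w. u @ instantiate x a w \<in> C'}" if "u \<in> C'" "a \<in> A" for u a
      using instantiate[OF that(2), of "{v. u @ v \<in> C}"] that(1) by (simp add: C'_def)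
    then have "q (\<Inter>\<F>)"
      using D A(1) q by (intro ultra_Inter[OF q(1)]) (auto simp: \<F>_def C'_def)
    then obtain w where w: "w \<in> \<Inter>\<F>" using ultra_not_empty[OF q(1)] by (metis ex_in_conv)
    then have w': "w \<in> X" if "X \<in> \<F>" for X using that by blast
    have "u @ w \<in> C" if "u \<in> D" for u
    proof -
      have "{w. u @ w \<in> C} \<in> \<F>" using that by (simp add: \<F>_def)
      then show ?thesis using w' by blast
    qed
    moreover have "u @ instantiate x a w \<in> C'" if "u \<in> D" "a \<in> A" for u a
    proof -
      have "{w. u @ instantiate x a w \<in> C'} \<in> \<F>" using that by (force simp: \<F>_def)
      then show ?thesis using w' by blast
    qed
    moreover have "w \<in> V" by (rule w') (simp add: \<F>_def)
    ultimately show ?thesis by blast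
  qed
  define good where "good D w \<longleftrightarrow> finite D \<and> D \<subseteq> C' \<and> w \<in> V \<and>
    (\<forall>u\<in>D. u @ w \<in> C \<and> (\<forall>a\<in>A. u @ instantiate x a w \<in> C'))" for D w
  \<comment> \<open>The first component of \<open>f n\<close> collects all instances of the first
    \<open>n\<close> blocks, the second is the next block.\<close>
  have "\<exists>f. \<forall>n. (good (fst (f n)) (snd (f n)) \<and> (n = 0 \<longrightarrow> fst (f n) = {[]})) \<and>
    fst (f (Suc n)) = (\<lambda>(u, a). u @ instantiate x a (snd (f n))) ` (fst (f n) \<times> A)"
  proof (rule dependent_nat_choice)
    have "[] \<in> C'" using c0 by (simp add: C'_def C_def)
    then obtain w where "good {[]} w" using ext[of "{[]}"] by (auto simp: good_def)
    then show "\<exists>s. good (fst s) (snd s) \<and> (0 = 0 \<longrightarrow> fst s = {[]})"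
      by (intro exI[of _ "({[]}, w)"]) simp
  next
    fix s and n :: nat assume s: "good (fst s) (snd s) \<and> (n = 0 \<longrightarrow> fst s = {[]})"
    define D' where "D' = (\<lambda>(u, a). u @ instantiate x a (snd s)) ` (fst s \<times> A)"
    have "finite D'" "D' \<subseteq> C'" using s A(1) by (auto simp: D'_def good_def)
    then obtain w where "good D' w" using ext[of D'] by (auto simp: good_def)
    then show "\<exists>t. (good (fst t) (snd t) \<and> (Suc n = 0 \<longrightarrow> fst t = {[]})) \<and>
        fst t = (\<lambda>(u, a). u @ instantiate x a (snd s)) ` (fst s \<times> A)"
      by (intro exI[of _ "(D', w)"]) (simp add: D'_def)
  qed
  then obtain f where f': "\<forall>n. (good (fst (f n)) (snd (f n)) \<and> (n = 0 \<longrightarrow> fst (f n) = {[]})) \<and>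
    fst (f (Suc n)) = (\<lambda>(u, a). u @ instantiate x a (snd (f n))) ` (fst (f n) \<times> A)"
    by (rule exE)
  have f: "good (fst (f n)) (snd (f n))" "fst (f 0) = {[]}"
    "fst (f (Suc n)) = (\<lambda>(u, a). u @ instantiate x a (snd (f n))) ` (fst (f n) \<times> A)" for n
    using f' by blast+
  define w where "w n = snd (f n)" for n
  have wV: "w n \<in> V" for n using f(1)[of n] by (simp add: good_def w_def)
  define F where "F v = concat (map (\<lambda>i. instantiate x (v ! i) (w i)) [0..<length v])" for v
  have F_snoc: "F (v @ [a]) = F v @ instantiate x a (w (length v))" for v a
  proof -
    have "map (\<lambda>i. instantiate x ((v @ [a]) ! i) (w i)) [0..<length v] = map (\<lambda>i. instantiate x (v ! i) (w i)) [0..<length v]"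
      by (simp add: nth_append)
    then show ?thesis unfolding F_def by (simp del: map_eq_conv)
  qed
  have F: "F v \<in> fst (f (length v)) \<and> set (F v) \<subseteq> A" if "v \<in> lists A" for v
    using that
  proof (induction v rule: rev_induct)
    case Nil then show ?case by (simp add: F_def f(2))
  next
    case (snoc a v)
    then have "F v \<in> fst (f (length v))" "set (F v) \<subseteq> A" "a \<in> A" by auto
    then show ?case
      using variable_words_instantiate[of "w (length v)" A x a] wV
      by (auto simp: F_snoc f(3) w_def[symmetric] V_def)
  qed
  show ?thesis
  proof (intro exI[of _ w] exI[of _ c0] conjI allI ballI)
    show "w j \<in> variable_words A x" for j using wV by (simp add: V_def)
    fix v assume v: "v \<in> lists A"
    have "F v @ w (length v) \<in> C"
      using F[OF v] f(1)[of "length v"] by (auto simp: good_def w_def)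
    then have "c (pre (F v @ w (length v))) = c0" by (simp add: C_def)
    \<comment> \<open>\<open>F v\<close> is variable-free, so the first \<open>x\<close> lies in the
      last block.\<close>
    moreover have "pre (F v @ w (length v)) = F v @ pre (w (length v))"
      using F[OF v] A(2) unfolding pre_def by (intro takeWhile_append2) auto
    ultimately show "c (concat (map (\<lambda>i. instantiate x (v ! i) (w i)) [0..<length v]) @
        takeWhile (\<lambda>b. b \<noteq> x) (w (length v))) = c0"
      by (simp add: F_def pre_def)
  qed
qed

section \<open>Infinite-parameter words\<close>

definition letters :: "'a set \<Rightarrow> nat \<Rightarrow> 'a letter set" where
  "letters \<Sigma> m = Sym ` \<Sigma> \<union> Par ` {..<m}"

lemma finite_letters: "finite \<Sigma> \<Longrightarrow> finite (letters \<Sigma> m)"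
  by (simp add: letters_def)

lemma letters_mono: "m \<le> n \<Longrightarrow> letters \<Sigma> m \<subseteq> letters \<Sigma> n"
  by (auto simp: letters_def)

lemma subst_letter_letters:
  assumes "l \<in> letters \<Sigma> (length u)" "set u \<subseteq> letters \<Sigma> m"
  shows "subst_letter (Fin u) l \<in> letters \<Sigma> m"
proof (cases l)
  case (Par i)
  then have "u ! i \<in> set u" using assms(1) by (auto simp: letters_def)
  then show ?thesis using Par assms(2) by auto
qed (use assms(1) in \<open>auto simp: letters_def\<close>)

lemma subst_letter_subst_letter:
  "l \<in> letters \<Sigma> (length e) \<Longrightarrow>
    subst_letter (Fin u) (subst_letter (Fin e) l) = subst_letter (Fin (map (subst_letter (Fin u)) e)) l"
  by (auto simp: letters_def)

definition identity_word :: "nat \<Rightarrow> 'a letter list" where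
  "identity_word m = map Par [0..<m]"

lemma length_identity_word [simp]: "length (identity_word m) = m"
  by (simp add: identity_word_def)

lemma identity_word_Suc: "identity_word (Suc m) = identity_word m @ [Par m]"
  by (simp add: identity_word_def)

lemma set_identity_word: "set (identity_word m) \<subseteq> letters \<Sigma> m"
  by (auto simp: identity_word_def letters_def)

lemma subst_identity_word:
  "set z \<subseteq> letters \<Sigma> m \<Longrightarrow> map (subst_letter (Fin (identity_word m @ v))) z = z"
  by (rule map_idI) (auto simp: letters_def identity_word_def nth_append subset_iff)

lemma map_subst_letter_identity_word:
  "map (subst_letter (Fin (w @ v))) (identity_word (length w)) = w"
  by (rule nth_equalityI) (auto simp: identity_word_def nth_append)

text \<open>An infinite-parameter word \<open>W\<close> is represented by the sequence of its prefixes \<open>E i\<close>, where \<open>E i\<close>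
  ends just before the first \<open>Par i\<close>. Then \<open>W(U)\<close> only depends on \<open>E\<close> at the length of \<open>U\<close>.\<close>

definition inf_word :: "'a set \<Rightarrow> (nat \<Rightarrow> 'a letter list) \<Rightarrow> bool" where
  "inf_word \<Sigma> E \<longleftrightarrow> (\<forall>i. set (E i) \<subseteq> letters \<Sigma> i \<and> (\<exists>b. E (Suc i) = E i @ Par i # b))"

definition subst_inf :: "(nat \<Rightarrow> 'a letter list) \<Rightarrow> 'a letter list \<Rightarrow> 'a letter list" where
  "subst_inf E u = map (subst_letter (Fin u)) (E (length u))"

lemma inf_wordD:
  assumes "inf_word \<Sigma> E"
  shows "set (E i) \<subseteq> letters \<Sigma> i" "\<exists>b. E (Suc i) = E i @ Par i # b"
  using assms by (auto simp: inf_word_def)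

lemma inf_word_extends:
  assumes "inf_word \<Sigma> E" "i < j"
  shows "\<exists>b. E j = E i @ Par i # b"
  using assms(2)
proof (induction j)
  case (Suc j)
  show ?case
  proof (cases "i = j")
    case False
    then obtain b b' where "E j = E i @ Par i # b" "E (Suc j) = E j @ Par j # b'"
      using Suc inf_wordD(2)[OF assms(1)] by (metis less_antisym)
    then show ?thesis by simp
  qed (use inf_wordD(2)[OF assms(1)] in simp)
qed simp

lemma inf_word_identity_word: "inf_word \<Sigma> identity_word"
  unfolding inf_word_def using set_identity_word identity_word_Suc by fastforce

lemma subst_inf_identity_word:
  assumes "inf_word \<Sigma> E" shows "subst_inf E (identity_word m) = E m"
  using subst_identity_word[of "E m" \<Sigma> m "[]"] inf_wordD(1)[OF assms] by (simp add: subst_inf_def)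

lemma subst_inf_map:
  assumes "inf_word \<Sigma> E"
  shows "subst_inf E (map (subst_letter (Fin u)) z) = map (subst_letter (Fin u)) (subst_inf E z)"
  using inf_wordD(1)[OF assms, of "length z"]
  by (auto simp: subst_inf_def subset_iff intro!: subst_letter_subst_letter[symmetric])

text \<open>Associativity of substitution: the composite of \<open>E\<close> and \<open>F\<close> is
  the word with prefixes \<open>subst_inf E (F i)\<close>.\<close>

lemma subst_inf_subst_inf:
  assumes "inf_word \<Sigma> E"
  shows "subst_inf E (subst_inf F u) = subst_inf (\<lambda>i. subst_inf E (F i)) u"
  using subst_inf_map[OF assms, of u "F (length u)"] by (simp add: subst_inf_def)

lemma subst_inf_letters:
  assumes "inf_word \<Sigma> E" "set u \<subseteq> letters \<Sigma> m"
  shows "set (subst_inf E u) \<subseteq> letters \<Sigma> m"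
  using inf_wordD(1)[OF assms(1), of "length u"] subst_letter_letters[OF _ assms(2)]
  by (auto simp: subst_inf_def subset_iff)

text \<open>\<open>E (length w)\<close> contains only parameters below \<open>length w\<close>, so
  the image of \<open>w\<close> starts the image of every longer word beginning with
  \<open>w\<close>. The next letter comes from \<open>Par (length w)\<close> and is therefore
  \<open>a\<close>.\<close>

lemma subst_inf_append:
  assumes E: "inf_word \<Sigma> E" and u: "set (w @ a # v) \<subseteq> letters \<Sigma> m"
  shows "\<exists>v'. subst_inf E (w @ a # v) = subst_inf E w @ a # v' \<and> set v' \<subseteq> letters \<Sigma> m"
proof -
  obtain b where b: "E (length (w @ a # v)) = E (length w) @ Par (length w) # b"
    using inf_word_extends[OF E, of "length w" "length (w @ a # v)"] by auto
  have "map (subst_letter (Fin (w @ a # v))) (E (length w)) = subst_inf E w"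
    using inf_wordD(1)[OF E, of "length w"]
    by (auto simp: subst_inf_def letters_def nth_append subset_iff)
  then have "subst_inf E (w @ a # v) = subst_inf E w @ a # map (subst_letter (Fin (w @ a # v))) b"
    by (simp add: subst_inf_def[of E "w @ a # v"] b nth_append del: length_append)
  then show ?thesis
    using subst_inf_letters[OF E u] by auto
qed

lemma inf_word_comp:
  assumes "inf_word \<Sigma> E" "inf_word \<Sigma> F"
  shows "inf_word \<Sigma> (\<lambda>i. subst_inf E (F i))"
  unfolding inf_word_def
proof (intro allI conjI)
  fix i
  show "set (subst_inf E (F i)) \<subseteq> letters \<Sigma> i"
    using subst_inf_letters inf_wordD(1) assms by metis
  obtain b where b: "F (Suc i) = F i @ Par i # b" using inf_wordD(2)[OF assms(2)] by auto
  then show "\<exists>b. subst_inf E (F (Suc i)) = subst_inf E (F i) @ Par i # b"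
    using subst_inf_append[OF assms(1), of "F i" "Par i" b "Suc i"] inf_wordD(1)[OF assms(2), of "Suc i"] by auto
qed

lemma instantiate_subst:
  assumes "w \<in> variable_words (letters \<Sigma> m) (Par m)" "i < length v"
  shows "map (subst_letter (Fin (identity_word m @ v))) (instantiate (Par m) (Par (m + i)) w) = instantiate (Par m) (v ! i) w"
  using assms
  by (auto simp: variable_words_def instantiate_def letters_def identity_word_def nth_append subset_iff)

text \<open>The first \<open>m\<close> parameters are treated as letters and \<open>Par m\<close> as
  the variable. Block number \<open>i\<close> has its variable replaced by
  \<open>Par (m + i)\<close>, and the blocks are strung together after
  \<open>identity_word m\<close>.\<close>

lemma Carlson_Simpson_inf_word:
  assumes \<Sigma>: "finite \<Sigma>" and c: "finite (c ` lists (letters \<Sigma> m))"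
  shows "\<exists>U c0. inf_word \<Sigma> U \<and> (\<forall>j<m. U j = identity_word j) \<and>
    (\<forall>v\<in>lists (letters \<Sigma> m). c (subst_inf U (identity_word m @ v)) = c0)"
proof -
  let ?L = "letters \<Sigma> m" and ?x = "Par m :: 'a letter"
  define pre where "pre = takeWhile (\<lambda>b. b \<noteq> ?x)"
  have "(\<lambda>u. c (identity_word m @ u)) ` lists ?L \<subseteq> c ` lists ?L"
    using set_identity_word[of m \<Sigma>] by (auto intro!: imageI)
  then have fin: "finite ((\<lambda>u. c (identity_word m @ u)) ` lists ?L)"
    using c finite_subset by blast
  have "?x \<notin> ?L" by (auto simp: letters_def)
  then obtain w c0 where "\<forall>j. w j \<in> variable_words ?L ?x"
    and c0: "\<forall>v\<in>lists ?L.
      c (identity_word m @ concat (map (\<lambda>i. instantiate ?x (v ! i) (w i)) [0..<length v]) @ pre (w (length v))) = c0"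
    using Carlson_Simpson[OF finite_letters[OF \<Sigma>] _ fin] unfolding pre_def by blast
  then have w: "w j \<in> variable_words ?L ?x" for j by blast
  define G where "G j = concat (map (\<lambda>i. instantiate ?x (Par (m + i)) (w i)) [0..<j])" for j
  \<comment> \<open>\<open>U j\<close> must stop just before the first \<open>Par j\<close>, which
    is the first variable of block \<open>j - m\<close>; hence the final \<open>pre\<close>.\<close>
  define U where "U j = (if j < m then identity_word j else identity_word m @ G (j - m) @ pre (w (j - m)))" for j
  have pre_L: "set (pre (w j)) \<subseteq> ?L" for j
    using w[of j] unfolding pre_def variable_words_def by (auto dest!: set_takeWhileD)
  have w_split: "\<exists>b. w j = pre (w j) @ ?x # b" for j
  proof -
    have "?x \<in> set (w j)" using w by (simp add: variable_words_def)
    then obtain as bs where "w j = as @ ?x # bs" "?x \<notin> set as" by (metis split_list_first)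
    then show ?thesis unfolding pre_def by (auto simp: takeWhile_append)
  qed
  have set_instantiate: "set (instantiate ?x (Par (m + i)) (w i)) \<subseteq> letters \<Sigma> (m + j)" if "i < j" for i j
    using w[of i] that by (auto simp: variable_words_def instantiate_def letters_def subset_iff)
  have set_U: "set (U j) \<subseteq> letters \<Sigma> j" for j
  proof (cases "j < m")
    case False
    have "set (G (j - m)) \<subseteq> letters \<Sigma> j"
      using set_instantiate[of _ "j - m"] False by (fastforce simp: G_def)
    then show ?thesis
      using False pre_L[of "j - m"] set_identity_word[of m \<Sigma>] letters_mono[of m j \<Sigma>] by (auto simp: U_def)
  qed (simp add: U_def set_identity_word)
  have "\<exists>b. U (Suc j) = U j @ Par j # b" for j
  proof -
    consider "Suc j < m" | "Suc j = m" | "m \<le> j" by linarith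
    then show ?thesis
    proof cases
      case 3
      obtain b where b: "w (j - m) = pre (w (j - m)) @ ?x # b" using w_split by blast
      have "instantiate ?x (Par j) (pre (w (j - m))) = pre (w (j - m))"
        unfolding instantiate_def pre_def by (rule map_idI) (auto dest!: set_takeWhileD)
      then have "instantiate ?x (Par j) (w (j - m)) = pre (w (j - m)) @ Par j # instantiate ?x (Par j) b"
        by (subst b) (simp add: instantiate_def)
      then have "G (Suc j - m) = G (j - m) @ pre (w (j - m)) @ Par j # instantiate ?x (Par j) b"
        using 3 by (simp add: G_def Suc_diff_le)
      then show ?thesis using 3 by (simp add: U_def)
    qed (auto simp: U_def identity_word_Suc G_def)
  qed
  then have U: "inf_word \<Sigma> U" using set_U by (simp add: inf_word_def)
  show ?thesis
  proof (intro exI[of _ U] exI[of _ c0] conjI allI ballI impI)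
    show "U j = identity_word j" if "j < m" for j using that by (simp add: U_def)
    fix v assume v: "v \<in> lists ?L"
    have "map (subst_letter (Fin (identity_word m @ v))) (G (length v)) =
        concat (map (\<lambda>i. instantiate ?x (v ! i) (w i)) [0..<length v])"
      unfolding G_def map_concat map_map comp_def
      by (intro arg_cong[where f = concat] map_cong refl instantiate_subst[OF w]) simp
    moreover have "map (subst_letter (Fin (identity_word m @ v))) (identity_word m) = identity_word m"
      using map_subst_letter_identity_word[of "identity_word m" v] by simp
    moreover have "map (subst_letter (Fin (identity_word m @ v))) (pre (w (length v))) = pre (w (length v))"
      using subst_identity_word pre_L by metis
    ultimately have "subst_inf U (identity_word m @ v) =
        identity_word m @ concat (map (\<lambda>i. instantiate ?x (v ! i) (w i)) [0..<length v]) @ pre (w (length v))"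
      by (simp add: subst_inf_def U_def)
    then show "c (subst_inf U (identity_word m @ v)) = c0" using c0 v by simp
  qed (rule U)
qed

text \<open>The \<open>n\<close>-parameter words, split at the first occurrence of the last parameter.\<close>

primrec param_words :: "'a set \<Rightarrow> nat \<Rightarrow> 'a letter list set" where
  "param_words \<Sigma> 0 = lists (letters \<Sigma> 0)"
| "param_words \<Sigma> (Suc n) = {w @ Par n # v | w v. w \<in> param_words \<Sigma> n \<and> v \<in> lists (letters \<Sigma> (Suc n))}"

lemma param_words_letters: "w \<in> param_words \<Sigma> n \<Longrightarrow> set w \<subseteq> letters \<Sigma> n"
proof (induction n arbitrary: w)
  case (Suc n)
  then obtain w' v where *: "w = w' @ Par n # v" "w' \<in> param_words \<Sigma> n" "v \<in> lists (letters \<Sigma> (Suc n))" by auto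
  then show ?case using Suc.IH[of w'] letters_mono[of n "Suc n" \<Sigma>]
    by (auto simp: letters_def)
qed auto

lemma param_words_params: "w \<in> param_words \<Sigma> n \<Longrightarrow> i < n \<Longrightarrow> Par i \<in> set w"
  by (induction n arbitrary: w) (auto simp: less_Suc_eq)

lemma subst_inf_param_words:
  assumes "inf_word \<Sigma> E" shows "w \<in> param_words \<Sigma> n \<Longrightarrow> subst_inf E w \<in> param_words \<Sigma> n"
proof (induction n arbitrary: w)
  case 0 then show ?case using subst_inf_letters[OF assms, of w 0] by auto
next
  case (Suc n)
  then obtain w' v where *: "w = w' @ Par n # v" "w' \<in> param_words \<Sigma> n" "v \<in> lists (letters \<Sigma> (Suc n))" by auto
  obtain v' where "subst_inf E w = subst_inf E w' @ Par n # v'" "set v' \<subseteq> letters \<Sigma> (Suc n)"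
    using subst_inf_append[OF assms, of w' "Par n" v "Suc n"] param_words_letters[OF Suc.prems] *(1) by auto
  then show ?case using Suc.IH[OF *(2)] by auto
qed

section \<open>Ramsey theorem for finite parameter words\<close>

text \<open>Passing to \<open>E\<close> makes the colour depend only on the part before the first
  \<open>Par n\<close>. Stage \<open>i\<close> treats the parts of length \<open>i\<close>. Later
  stages keep the prefixes with index up to \<open>i\<close>, so the stages converge.\<close>

lemma fusion:
  fixes \<chi> :: "'a letter list \<Rightarrow> 'c"
  assumes \<Sigma>: "finite \<Sigma>" and \<chi>: "finite (\<chi> ` param_words \<Sigma> (Suc n))"
  shows "\<exists>E. inf_word \<Sigma> E \<and> (\<forall>w\<in>param_words \<Sigma> n. \<forall>v\<in>lists (letters \<Sigma> (Suc n)).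
    \<chi> (subst_inf E (w @ Par n # v)) = \<chi> (subst_inf E (w @ [Par n])))"
proof -
  let ?L = "lists (letters \<Sigma> (Suc n))"
  define good where "good i E \<longleftrightarrow> (\<forall>w\<in>param_words \<Sigma> n. length w = i \<longrightarrow>
    (\<forall>v\<in>?L. \<chi> (subst_inf E (w @ Par n # v)) = \<chi> (subst_inf E (w @ [Par n]))))" for i E
  have wv: "set (w @ Par n # v) \<subseteq> letters \<Sigma> (Suc n)" if "w \<in> param_words \<Sigma> n" "v \<in> ?L" for w v
    using param_words_letters[OF that(1)] that(2) letters_mono[of n "Suc n" \<Sigma>] by (auto simp: letters_def)
  \<comment> \<open>Since \<open>U\<close> fixes every \<open>w\<close> of length \<open>i\<close>,
    it only changes the tail after \<open>w @ [Par n]\<close>, and \<open>good i\<close> covers all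
    tails.\<close>
  have good_comp: "good i (\<lambda>j. subst_inf E (U j))"
    if "inf_word \<Sigma> E" "inf_word \<Sigma> U" "good i E" "U i = identity_word i" for i E U
    unfolding good_def
  proof (intro ballI impI)
    fix w v assume w: "w \<in> param_words \<Sigma> n" "length w = i" and v: "v \<in> ?L"
    have "subst_inf U w = w" using that(4) w(2) map_subst_letter_identity_word[of w "[]"] by (simp add: subst_inf_def)
    then have "\<exists>v'. subst_inf U (w @ Par n # v) = w @ Par n # v' \<and> v' \<in> ?L" if "v \<in> ?L" for v
      using subst_inf_append[OF \<open>inf_word \<Sigma> U\<close> wv[OF w(1) that]] by auto
    then have "\<chi> (subst_inf E (subst_inf U (w @ Par n # v))) = \<chi> (subst_inf E (w @ [Par n]))" if "v \<in> ?L" for v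
      using \<open>good i E\<close> w that unfolding good_def by metis
    from this[OF v] this[of "[]"]
    show "\<chi> (subst_inf (\<lambda>j. subst_inf E (U j)) (w @ Par n # v)) = \<chi> (subst_inf (\<lambda>j. subst_inf E (U j)) (w @ [Par n]))"
      by (simp add: subst_inf_subst_inf[OF that(1)])
  qed
  have step: "\<exists>U. inf_word \<Sigma> U \<and> (\<forall>j\<le>i. U j = identity_word j) \<and> good i (\<lambda>j. subst_inf E (U j))"
    if E: "inf_word \<Sigma> E" for i E
  proof -
    define D where "D = {w \<in> param_words \<Sigma> n. length w = i}"
    \<comment> \<open>One application handles all prefixes \<open>w\<close> of length \<open>i\<close> at once: the parameters up to \<open>i\<close> are
      treated as letters, and \<open>w @ [Par n]\<close> is substituted for them afterwards.\<close>
    define c where "c z = (\<lambda>w\<in>D. let y = subst_inf E (map (subst_letter (Fin (w @ [Par n]))) z)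
      in if y \<in> param_words \<Sigma> (Suc n) then \<chi> y else undefined)" for z
    have "D \<subseteq> {xs. set xs \<subseteq> letters \<Sigma> n \<and> length xs = i}"
      using param_words_letters by (auto simp: D_def)
    then have "finite D"
      by (rule finite_subset) (rule finite_lists_length_eq[OF finite_letters[OF \<Sigma>]])
    have "range c \<subseteq> (\<Pi>\<^sub>E w\<in>D. insert undefined (\<chi> ` param_words \<Sigma> (Suc n)))"
      unfolding c_def by (auto simp: Let_def restrict_PiE_iff simp del: param_words.simps)
    moreover have "finite (\<Pi>\<^sub>E w\<in>D. insert undefined (\<chi> ` param_words \<Sigma> (Suc n)))"
      using \<chi> \<open>finite D\<close> by (intro finite_PiE) (simp_all del: param_words.simps)
    ultimately have "finite (range c)" by (rule finite_subset)
    then have "finite (c ` lists (letters \<Sigma> (Suc i)))"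
      by (rule finite_subset[rotated]) blast
    then obtain U c0 where U: "inf_word \<Sigma> U" "\<forall>j<Suc i. U j = identity_word j"
      and c0: "\<forall>v\<in>lists (letters \<Sigma> (Suc i)). c (subst_inf U (identity_word (Suc i) @ v)) = c0"
      using Carlson_Simpson_inf_word[OF \<Sigma>] by blast
    have "good i (\<lambda>j. subst_inf E (U j))"
      unfolding good_def
    proof (intro ballI impI)
      fix w v assume w: "w \<in> param_words \<Sigma> n" "length w = i" and v: "v \<in> ?L"
      let ?s = "subst_letter (Fin (w @ [Par n]))"
      have "\<chi> (subst_inf E (subst_inf U (w @ Par n # v))) = c0 w" if v: "v \<in> ?L" for v
      proof -
        \<comment> \<open>All parameters up to \<open>n\<close> occur in \<open>w @ [Par n]\<close>.
          A parameter at position \<open>p\<close> there is the value of \<open>Par p\<close>, so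
          every tail \<open>v\<close> is the image under \<open>?s\<close> of some \<open>v'\<close>
          over \<open>letters \<Sigma> (Suc i)\<close>.\<close>
        have "\<exists>l'\<in>letters \<Sigma> (Suc i). ?s l' = l" if "l \<in> letters \<Sigma> (Suc n)" for l
        proof (cases l)
          case (Par j)
          then have "j < Suc n" using that by (auto simp: letters_def)
          then have "l \<in> set (w @ [Par n])" using param_words_params[OF w(1), of j] Par by (auto simp: less_Suc_eq)
          then obtain p where "p < Suc i" "(w @ [Par n]) ! p = l" using w(2) by (metis in_set_conv_nth length_append_singleton)
          then show ?thesis by (intro bexI[of _ "Par p"]) (auto simp: letters_def)
        next
          case (Sym a)
          then show ?thesis using that by (intro bexI[of _ l]) (auto simp: letters_def)
        qed
        then obtain g where g: "\<And>l. l \<in> letters \<Sigma> (Suc n) \<Longrightarrow> g l \<in> letters \<Sigma> (Suc i) \<and> ?s (g l) = l"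
          by metis
        define v' where "v' = map g v"
        have v': "v' \<in> lists (letters \<Sigma> (Suc i))" "map ?s v' = v"
          using v g by (auto simp: v'_def intro!: map_idI)
        have "map ?s (identity_word (Suc i) @ v') = w @ Par n # v"
          using map_subst_letter_identity_word[of "w @ [Par n]" "[]"] v'(2) w(2) by simp
        then have "subst_inf U (w @ Par n # v) = map ?s (subst_inf U (identity_word (Suc i) @ v'))"
          using subst_inf_map[OF U(1)] by metis
        moreover have "w @ Par n # v \<in> param_words \<Sigma> (Suc n)" using w(1) v by auto
        then have "subst_inf E (subst_inf U (w @ Par n # v)) \<in> param_words \<Sigma> (Suc n)"
          by (intro subst_inf_param_words[OF E] subst_inf_param_words[OF U(1)])
        ultimately have "c (subst_inf U (identity_word (Suc i) @ v')) w = \<chi> (subst_inf E (subst_inf U (w @ Par n # v)))"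
          using w by (simp add: c_def D_def del: param_words.simps)
        then show ?thesis using c0 v'(1) by simp
      qed
      from this[OF v] this[of "[]"]
      show "\<chi> (subst_inf (\<lambda>j. subst_inf E (U j)) (w @ Par n # v)) = \<chi> (subst_inf (\<lambda>j. subst_inf E (U j)) (w @ [Par n]))"
        by (simp add: subst_inf_subst_inf[OF E])
    qed
    then show ?thesis using U by (intro exI[of _ U]) (auto simp: less_Suc_eq_le)
  qed
  have "\<exists>f. \<forall>i. (inf_word \<Sigma> (f i) \<and> (\<forall>j<i. good j (f i))) \<and> (\<forall>j\<le>i. f (Suc i) j = f i j)"
  proof (rule dependent_nat_choice)
    show "\<exists>E. inf_word \<Sigma> E \<and> (\<forall>j<0. good j E)" using inf_word_identity_word by blast
  next
    fix E i assume E: "inf_word \<Sigma> E \<and> (\<forall>j<i. good j E)"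
    then obtain U where U: "inf_word \<Sigma> U" "\<forall>j\<le>i. U j = identity_word j" "good i (\<lambda>j. subst_inf E (U j))"
      using step by blast
    have "good j (\<lambda>j. subst_inf E (U j))" if "j < Suc i" for j
      using that U good_comp[of E U j] E by (cases "j = i") auto
    moreover have "\<forall>j\<le>i. subst_inf E (U j) = E j"
      using U(2) subst_inf_identity_word E by metis
    ultimately show "\<exists>E'. (inf_word \<Sigma> E' \<and> (\<forall>j<Suc i. good j E')) \<and> (\<forall>j\<le>i. E' j = E j)"
      using inf_word_comp E U(1) by (intro exI[of _ "\<lambda>j. subst_inf E (U j)"]) blast
  qed
  then obtain f where f: "\<And>i. inf_word \<Sigma> (f i)" "\<And>i j. j < i \<Longrightarrow> good j (f i)"
    "\<And>i j. j \<le> i \<Longrightarrow> f (Suc i) j = f i j"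
    by blast
  \<comment> \<open>The diagonal limit: the prefix with index \<open>j\<close> is unchanged from
    stage \<open>j\<close> on.\<close>
  define E where "E j = f j j" for j
  have stable: "f N j = E j" if "j \<le> N" for N j
    using that
  proof (induction N)
    case (Suc N) then show ?case using f(3)[of j N] by (cases "j = Suc N") (auto simp: E_def)
  qed (simp add: E_def)
  show ?thesis
  proof (intro exI[of _ E] conjI ballI)
    show "inf_word \<Sigma> E"
      unfolding inf_word_def
    proof
      fix i
      show "set (E i) \<subseteq> letters \<Sigma> i \<and> (\<exists>b. E (Suc i) = E i @ Par i # b)"
        using inf_wordD[OF f(1), of "Suc i" i] stable[of i "Suc i"] stable[of "Suc i" "Suc i"]
        by simp
    qed
    fix w v assume w: "w \<in> param_words \<Sigma> n" and v: "v \<in> ?L"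
    \<comment> \<open>Stage \<open>N\<close> agrees with \<open>E\<close> on all words of length at
      most \<open>N\<close>, and it is already good for \<open>length w < N\<close>.\<close>
    define N where "N = length (w @ Par n # v)"
    have subst_inf: "subst_inf E u = subst_inf (f N) u" if "length u \<le> N" for u
      using stable[OF that] by (simp add: subst_inf_def)
    have "good (length w) (f N)" by (rule f(2)) (simp add: N_def)
    then have "\<chi> (subst_inf (f N) (w @ Par n # v)) = \<chi> (subst_inf (f N) (w @ [Par n]))"
      using w v unfolding good_def by blast
    then show "\<chi> (subst_inf E (w @ Par n # v)) = \<chi> (subst_inf E (w @ [Par n]))"
      using subst_inf[of "w @ Par n # v"] subst_inf[of "w @ [Par n]"] by (simp add: N_def)
  qed
qed

text \<open>After fusion the colour of a word with \<open>Suc n\<close> parameters is that of its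
  part \<open>w\<close> followed by \<open>Par n\<close> alone. This is a colouring of
  \<open>n\<close>-parameter words, to which the induction hypothesis applies.\<close>

lemma parameter_word_ramsey:
  assumes \<Sigma>: "finite \<Sigma>"
  shows "finite (\<chi> ` param_words \<Sigma> n) \<Longrightarrow>
    \<exists>E c0. inf_word \<Sigma> E \<and> (\<forall>w\<in>param_words \<Sigma> n. \<chi> (subst_inf E w) = c0)"
proof (induction n arbitrary: \<chi>)
  case 0
  then have "finite (\<chi> ` lists (letters \<Sigma> 0))" by simp
  then obtain U c0 where "inf_word \<Sigma> U" "\<forall>v\<in>lists (letters \<Sigma> 0). \<chi> (subst_inf U (identity_word 0 @ v)) = c0"
    using Carlson_Simpson_inf_word[OF \<Sigma>] by blast
  then show ?case by (intro exI[of _ U] exI[of _ c0]) (auto simp: identity_word_def)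
next
  case (Suc n)
  obtain E where E: "inf_word \<Sigma> E"
    "\<forall>w\<in>param_words \<Sigma> n. \<forall>v\<in>lists (letters \<Sigma> (Suc n)).
      \<chi> (subst_inf E (w @ Par n # v)) = \<chi> (subst_inf E (w @ [Par n]))"
    using fusion[OF \<Sigma> Suc.prems] by blast
  have "subst_inf E (w @ [Par n]) \<in> param_words \<Sigma> (Suc n)" if "w \<in> param_words \<Sigma> n" for w
  proof (rule subst_inf_param_words[OF E(1)])
    show "w @ [Par n] \<in> param_words \<Sigma> (Suc n)" using that by auto
  qed
  then have "(\<lambda>w. \<chi> (subst_inf E (w @ [Par n]))) ` param_words \<Sigma> n \<subseteq> \<chi> ` param_words \<Sigma> (Suc n)"
    by blast
  then have "finite ((\<lambda>w. \<chi> (subst_inf E (w @ [Par n]))) ` param_words \<Sigma> n)"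
    using Suc.prems finite_subset by blast
  then obtain F c0 where F: "inf_word \<Sigma> F" "\<forall>w\<in>param_words \<Sigma> n. \<chi> (subst_inf E (subst_inf F w @ [Par n])) = c0"
    using Suc.IH[of "\<lambda>w. \<chi> (subst_inf E (w @ [Par n]))"] by blast
  have "\<chi> (subst_inf (\<lambda>i. subst_inf E (F i)) q) = c0" if q_param_words: "q \<in> param_words \<Sigma> (Suc n)" for q
  proof -
    obtain w v where q: "q = w @ Par n # v" "w \<in> param_words \<Sigma> n" using \<open>q \<in> param_words \<Sigma> (Suc n)\<close> by auto
    then obtain v' where v': "subst_inf F q = subst_inf F w @ Par n # v'" "set v' \<subseteq> letters \<Sigma> (Suc n)"
      using subst_inf_append[OF F(1), of w "Par n" v "Suc n"] param_words_letters[OF q_param_words] by auto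
    have "v' \<in> lists (letters \<Sigma> (Suc n))" using v'(2) by auto
    then have "\<chi> (subst_inf E (subst_inf F q)) = \<chi> (subst_inf E (subst_inf F w @ [Par n]))"
      unfolding v'(1) by (rule bspec[OF bspec[OF E(2) subst_inf_param_words[OF F(1) q(2)]]])
    then show ?thesis using F(2) q(2) by (simp add: subst_inf_subst_inf[OF E(1)])
  qed
  then show ?case using inf_word_comp[OF E(1) F(1)] by blast
qed

text \<open>Each further \<open>n\<close> is handled by composing on the right, which maps parameter
  words to parameter words and so keeps the constancy already achieved.\<close>

lemma simultaneous_parameter_word_ramsey:
  assumes \<Sigma>: "finite \<Sigma>" and \<chi>: "\<And>n. finite (\<chi> n ` param_words \<Sigma> n)"
  shows "\<exists>E. inf_word \<Sigma> E \<and> (\<forall>n<N. \<exists>c0. \<forall>w\<in>param_words \<Sigma> n. \<chi> n (subst_inf E w) = c0)"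
proof (induction N)
  case 0 show ?case using inf_word_identity_word by blast
next
  case (Suc N)
  then obtain E where E: "inf_word \<Sigma> E" "\<forall>n<N. \<exists>c0. \<forall>w\<in>param_words \<Sigma> n. \<chi> n (subst_inf E w) = c0"
    by blast
  have "(\<lambda>w. \<chi> N (subst_inf E w)) ` param_words \<Sigma> N \<subseteq> \<chi> N ` param_words \<Sigma> N"
    using subst_inf_param_words[OF E(1)] by blast
  then have "finite ((\<lambda>w. \<chi> N (subst_inf E w)) ` param_words \<Sigma> N)" using \<chi> finite_subset by blast
  then obtain F c0 where F: "inf_word \<Sigma> F" "\<forall>w\<in>param_words \<Sigma> N. \<chi> N (subst_inf E (subst_inf F w)) = c0"
    using parameter_word_ramsey[OF \<Sigma>, of "\<lambda>w. \<chi> N (subst_inf E w)" N] by blast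
  have "\<exists>c0. \<forall>w\<in>param_words \<Sigma> n. \<chi> n (subst_inf E (subst_inf F w)) = c0" if "n < Suc N" for n
    using that E(2) F subst_inf_param_words[OF F(1)] by (cases "n = N") (auto simp: less_Suc_eq)
  then show ?case
    using inf_word_comp[OF E(1) F(1)] by (intro exI[of _ "\<lambda>i. subst_inf E (F i)"]) (simp add: subst_inf_subst_inf[OF E(1)])
qed

section \<open>Finite parameter words as lists\<close>

text \<open>The case \<open>length u = n\<close> needs no branch: \<open>Par n\<close> does not
  occur in an \<open>n\<close>-parameter word, so nothing is cut off.\<close>

definition subst_list :: "'a letter list \<Rightarrow> 'a letter list \<Rightarrow> 'a letter list" where
  "subst_list w u = map (subst_letter (Fin u)) (takeWhile (\<lambda>l. l \<noteq> Par (length u)) w)"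

lemma occurs_Fin: "occurs i (Fin w) \<longleftrightarrow> Par i \<in> set w"
  by (auto simp: occurs_def in_set_conv_nth)

lemma first_occ_Fin:
  assumes "Par i \<in> set w"
  shows "first_occ i (Fin w) = length (takeWhile (\<lambda>l. l \<noteq> Par i) w)"
  unfolding first_occ_def
proof (rule Least_equality)
  let ?t = "takeWhile (\<lambda>l. l \<noteq> Par i) w"
  have "length ?t < length w"
    using assms length_takeWhile_le[of "\<lambda>l. l \<noteq> Par i" w]
    by (metis (mono_tags, lifting) le_neq_implies_less takeWhile_eq_all_conv take_all_iff takeWhile_eq_take order_refl)
  moreover from this have "w ! length ?t = Par i" using nth_length_takeWhile by blast
  ultimately show "enat (length ?t) < wlength (Fin w) \<and> wnth (Fin w) (length ?t) = Par i" by simp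
  fix j assume "enat j < wlength (Fin w) \<and> wnth (Fin w) j = Par i"
  then have j: "w ! j = Par i" by simp
  show "length ?t \<le> j"
  proof (rule ccontr)
    assume "\<not> length ?t \<le> j"
    then have "j < length ?t" by simp
    then have "?t ! j \<in> set ?t" "?t ! j = w ! j" by (auto intro: takeWhile_nth)
    then show False using j by (metis (mono_tags, lifting) set_takeWhileD)
  qed
qed

lemma takeWhile_Par_id: "Par m \<notin> set w \<Longrightarrow> takeWhile (\<lambda>l. l \<noteq> Par m) w = w"
  by (induction w) auto

lemma param_words_takeWhile_id: "w \<in> param_words \<Sigma> n \<Longrightarrow> takeWhile (\<lambda>l. l \<noteq> Par n) w = w"
  using param_words_letters by (intro takeWhile_Par_id) (auto simp: letters_def)

lemma subst_Fin: "subst (Fin w) (Fin u) = Fin (subst_list w u)"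
proof -
  let ?t = "takeWhile (\<lambda>l. l \<noteq> Par (length u)) w"
  have "subst_length (Fin w) (Fin u) = enat (length ?t)"
    by (simp add: subst_length_def occurs_Fin first_occ_Fin takeWhile_Par_id)
  then have "subst (Fin w) (Fin u) = Fin (map (\<lambda>j. subst_letter (Fin u) (w ! j)) [0..<length ?t])"
    by (simp add: subst_def build_word_def)
  also have "map (\<lambda>j. subst_letter (Fin u) (w ! j)) [0..<length ?t] = subst_list w u"
    by (rule nth_equalityI) (simp_all add: subst_list_def takeWhile_nth)
  finally show ?thesis .
qed

lemma param_words_takeWhile:
  "w \<in> param_words \<Sigma> n \<Longrightarrow> m \<le> n \<Longrightarrow> takeWhile (\<lambda>l. l \<noteq> Par m) w \<in> param_words \<Sigma> m"
proof (induction n arbitrary: w)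
  case 0
  then show ?case using param_words_takeWhile_id[OF 0(1)] by (simp del: takeWhile_eq_all_conv)
next
  case (Suc n)
  show ?case
  proof (cases "m = Suc n")
    case True
    then show ?thesis using Suc.prems(1) param_words_takeWhile_id[OF Suc.prems(1)]
      by (simp del: takeWhile_eq_all_conv param_words.simps)
  next
    case False
    obtain w' v where w: "w = w' @ Par n # v" "w' \<in> param_words \<Sigma> n" using Suc.prems(1) by auto
    have "takeWhile (\<lambda>l. l \<noteq> Par m) w = takeWhile (\<lambda>l. l \<noteq> Par m) w'"
    proof (cases "m = n")
      case True
      then show ?thesis using w(1) param_words_takeWhile_id[OF w(2)]
        by (simp add: takeWhile_tail del: takeWhile_eq_all_conv)
    next
      case False
      then have "Par m \<in> set w'" using param_words_params[OF w(2), of m] Suc.prems(2) \<open>m \<noteq> Suc n\<close> by simp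
      then show ?thesis unfolding w(1) by (intro takeWhile_append1) auto
    qed
    then show ?thesis using Suc.IH[OF w(2)] Suc.prems(2) False by simp
  qed
qed

lemma takeWhile_Par_split:
  assumes "Par m \<in> set w"
  shows "\<exists>v. w = takeWhile (\<lambda>l. l \<noteq> Par m) w @ Par m # v"
proof -
  obtain a b where "w = a @ Par m # b" "Par m \<notin> set a" using split_list_first[OF assms] by blast
  then show ?thesis by (auto simp: takeWhile_append)
qed

lemma length_takeWhile_Par_less:
  assumes "w \<in> param_words \<Sigma> n" "i < j" "j \<le> n"
  shows "length (takeWhile (\<lambda>l. l \<noteq> Par i) w) < length (takeWhile (\<lambda>l. l \<noteq> Par j) w)"
proof -
  let ?t = "takeWhile (\<lambda>l. l \<noteq> Par j) w"
  have i: "Par i \<in> set ?t" using param_words_params[OF param_words_takeWhile[OF assms(1,3)] assms(2)] .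
  then obtain v where v: "?t = takeWhile (\<lambda>l. l \<noteq> Par i) ?t @ Par i # v"
    using takeWhile_Par_split by blast
  have "takeWhile (\<lambda>l. l \<noteq> Par i) (?t @ dropWhile (\<lambda>l. l \<noteq> Par j) w) = takeWhile (\<lambda>l. l \<noteq> Par i) ?t"
    using i by (intro takeWhile_append1) auto
  then show ?thesis using arg_cong[OF v, of length] by simp
qed

section \<open>Agreement of \<open>param_word\<close> with the recursive description
  \<open>param_words\<close>\<close>

lemma param_word_if_param_words:
  assumes "w \<in> param_words \<Sigma> n" shows "param_word \<Sigma> (enat n) (Fin w)"
  unfolding param_word_def
proof (intro conjI allI impI)
  fix j assume "enat j < wlength (Fin w)"
  then have "w ! j \<in> set w" by simp
  then show "wnth (Fin w) j \<in> Sym ` \<Sigma> \<union> Par ` {i. enat i < enat n}"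
    using param_words_letters[OF assms] by (auto simp: letters_def)
next
  fix i assume "enat i < enat n"
  then show "occurs i (Fin w)" using param_words_params[OF assms] by (simp add: occurs_Fin)
next
  fix j assume "1 \<le> j \<and> enat j < enat n"
  then show "first_occ (j - 1) (Fin w) < first_occ j (Fin w)"
    using param_words_params[OF assms, of "j - 1"] param_words_params[OF assms, of j]
      length_takeWhile_Par_less[OF assms, of "j - 1" j]
    by (auto simp: first_occ_Fin)
qed

lemma first_occ_mono:
  assumes "param_word \<Sigma> (enat n) W" "i < j" "j < n"
  shows "first_occ i W < first_occ j W"
  using assms(2,3)
proof (induction j)
  case (Suc j)
  have "first_occ j W < first_occ (Suc j) W"
    using assms(1) Suc.prems unfolding param_word_def by force
  then show ?case using Suc by (cases "i = j") auto
qed simp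

lemma first_occ_props:
  assumes "occurs i W"
  shows "enat (first_occ i W) < wlength W" "wnth W (first_occ i W) = Par i"
    "j < first_occ i W \<Longrightarrow> wnth W j \<noteq> Par i"
proof -
  have *: "enat (first_occ i W) < wlength W \<and> wnth W (first_occ i W) = Par i"
    using assms unfolding occurs_def first_occ_def by (rule LeastI_ex)
  then show "enat (first_occ i W) < wlength W" "wnth W (first_occ i W) = Par i" by auto
  assume j: "j < first_occ i W"
  then have "enat j < wlength W" using * by (meson enat_ord_simps(2) less_trans)
  then show "wnth W j \<noteq> Par i"
    using not_less_Least[OF j[unfolded first_occ_def]] by blast
qed

text \<open>Substituting a word of length at most \<open>n\<close> never reads \<open>W\<close>
  beyond the first \<open>Par n\<close>, so \<open>W\<close> may be cut there. \<open>W\<close> may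
  be infinite, as an envelope with finitely many parameters can be; the result \<open>g\<close> is
  always finite.\<close>

lemma truncate_param_word:
  fixes W :: "'a pword"
  assumes W: "param_word \<Sigma> (enat (Suc n)) W"
  defines "g \<equiv> map (wnth W) [0..<first_occ n W]"
  shows "param_word \<Sigma> (enat n) (Fin g)"
    and "length u \<le> n \<Longrightarrow> subst W (Fin u) = subst (Fin g) (Fin u)"
proof -
  have occ: "occurs i W" if "i \<le> n" for i using W that by (auto simp: param_word_def)
  note p = first_occ_props[OF occ[OF order_refl]]
  have less: "first_occ i W < first_occ n W" if "i < n" for i
    using first_occ_mono[OF W that] by simp
  have g_nth: "g ! j = wnth W j" if "j < first_occ n W" for j using that by (simp add: g_def)
  have len: "length g = first_occ n W" by (simp add: g_def)
  have occ_g: "occurs i (Fin g)" if "i < n" for i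
    unfolding occurs_def using less[OF that] first_occ_props[OF occ, of i] that
    by (intro exI[of _ "first_occ i W"]) (simp add: len g_nth)
  have first_g: "first_occ i (Fin g) = first_occ i W" if "i < n" for i
    unfolding first_occ_def[of i "Fin g"]
  proof (rule Least_equality)
    show "enat (first_occ i W) < wlength (Fin g) \<and> wnth (Fin g) (first_occ i W) = Par i"
      using less[OF that] first_occ_props[OF occ, of i] that by (simp add: len g_nth)
    fix j assume "enat j < wlength (Fin g) \<and> wnth (Fin g) j = Par i"
    then have "wnth W j = Par i" using g_nth[of j] by (simp add: len)
    then show "first_occ i W \<le> j"
      using first_occ_props(3)[OF occ, of i j] that by (meson less_imp_le not_le_imp_less)
  qed
  have letters: "wnth W j \<in> Sym ` \<Sigma> \<union> Par ` {i. enat i < enat n}" if "j < first_occ n W" for j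
  proof -
    have "enat j < wlength W" using that p(1) by (meson enat_ord_simps(2) less_trans)
    then have "wnth W j \<in> Sym ` \<Sigma> \<union> Par ` {i. enat i < enat (Suc n)}"
      using W by (auto simp: param_word_def)
    then show ?thesis using p(3)[OF that] by (auto simp: less_Suc_eq)
  qed
  show "param_word \<Sigma> (enat n) (Fin g)"
    unfolding param_word_def
  proof (intro conjI allI impI)
    fix j assume "enat j < wlength (Fin g)"
    then show "wnth (Fin g) j \<in> Sym ` \<Sigma> \<union> Par ` {i. enat i < enat n}"
      using letters by (simp add: len g_nth)
  next
    fix j assume "1 \<le> j \<and> enat j < enat n"
    then show "first_occ (j - 1) (Fin g) < first_occ j (Fin g)"
      using first_occ_mono[OF W, of "j - 1" j] first_g[of "j - 1"] first_g[of j] by auto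
  qed (simp add: occ_g)
  assume u: "length u \<le> n"
  have n_g: "\<not> occurs n (Fin g)"
    using p(3) by (auto simp: occurs_def len g_nth)
  have "subst_length W (Fin u) = subst_length (Fin g) (Fin u)"
    using u occ[OF u] occ_g first_g len n_g by (cases "length u = n") (auto simp: subst_length_def)
  moreover have "subst_length (Fin g) (Fin u) = enat m \<Longrightarrow> j < m \<Longrightarrow> wnth (Fin g) j = wnth W j" for m j
    using len g_nth less[of "length u"] u first_g n_g
    by (cases "length u = n") (auto simp: subst_length_def split: if_splits)
  moreover have "\<exists>m. subst_length (Fin g) (Fin u) = enat m"
    by (auto simp: subst_length_def)
  ultimately show "subst W (Fin u) = subst (Fin g) (Fin u)"
    by (auto simp: subst_def build_word_def)
qed

lemma param_words_if_param_word: "param_word \<Sigma> (enat n) (Fin w) \<Longrightarrow> w \<in> param_words \<Sigma> n"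
proof (induction n arbitrary: w)
  case 0
  have "x \<in> letters \<Sigma> 0" if "x \<in> set w" for x
    using that 0 by (auto simp: param_word_def letters_def in_set_conv_nth)
  then show ?case by auto
next
  case (Suc n)
  let ?p = "first_occ n (Fin w)"
  have "occurs n (Fin w)" using Suc.prems by (auto simp: param_word_def)
  from first_occ_props[OF this] have p: "?p < length w" "w ! ?p = Par n" by auto
  have "map (wnth (Fin w)) [0..<?p] = take ?p w"
    using p by (intro nth_equalityI) auto
  then have "take ?p w \<in> param_words \<Sigma> n"
    using Suc.IH truncate_param_word(1)[OF Suc.prems] by simp
  moreover have "x \<in> letters \<Sigma> (Suc n)" if "x \<in> set w" for x
    using that Suc.prems by (fastforce simp: param_word_def letters_def in_set_conv_nth)
  then have "drop (Suc ?p) w \<in> lists (letters \<Sigma> (Suc n))"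
    by (auto dest: in_set_dropD)
  moreover have "w = take ?p w @ Par n # drop (Suc ?p) w"
    using id_take_nth_drop[OF p(1)] p(2) by simp
  ultimately show ?case by auto
qed

lemma param_word_Fin_iff: "param_word \<Sigma> (enat n) (Fin w) \<longleftrightarrow> w \<in> param_words \<Sigma> n"
  using param_word_if_param_words param_words_if_param_word by blast

text \<open>Associativity with a truncating inner substitution: the image of \<open>w\<close> is cut
  before \<open>Par (length u)\<close> exactly at the image of the cut of \<open>w\<close>.\<close>

lemma subst_inf_subst_list:
  assumes E: "inf_word \<Sigma> E" and w: "w \<in> param_words \<Sigma> n" and u: "length u \<le> n"
  shows "subst_inf E (subst_list w u) = subst_list (subst_inf E w) u"
proof -
  let ?w = "takeWhile (\<lambda>l. l \<noteq> Par (length u)) w"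
  have "takeWhile (\<lambda>l. l \<noteq> Par (length u)) (subst_inf E w) = subst_inf E ?w"
  proof (cases "length u = n")
    case True
    then show ?thesis
      using param_words_takeWhile_id[OF w] param_words_takeWhile_id[OF subst_inf_param_words[OF E w]]
      by (simp del: takeWhile_eq_all_conv)
  next
    case False
    have w': "?w \<in> param_words \<Sigma> (length u)" using param_words_takeWhile[OF w u] .
    have "Par (length u) \<in> set w" using param_words_params[OF w] u False by simp
    then obtain v where v: "w = ?w @ Par (length u) # v" using takeWhile_Par_split by blast
    then obtain v' where v': "subst_inf E w = subst_inf E ?w @ Par (length u) # v'"
      using subst_inf_append[OF E, of ?w "Par (length u)" v n] param_words_letters[OF w] by metis
    show ?thesis using param_words_takeWhile_id[OF subst_inf_param_words[OF E w']] by (simp add: v' takeWhile_tail)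
  qed
  then show ?thesis using subst_inf_map[OF E, of u ?w] by (simp add: subst_list_def)
qed

text \<open>Every \<open>Par i\<close> with \<open>i < length u\<close> survives the truncation, so
  every letter of \<open>u\<close> shows up in the result.\<close>

lemma subst_list_letters:
  assumes "w \<in> param_words \<Sigma> n" "length u \<le> n"
  shows "set u \<subseteq> set (subst_list w u)"
proof
  fix l assume "l \<in> set u"
  then obtain i where i: "i < length u" "u ! i = l" by (auto simp: in_set_conv_nth)
  have "Par i \<in> set (takeWhile (\<lambda>l. l \<noteq> Par (length u)) w)"
    using param_words_params[OF param_words_takeWhile[OF assms] i(1)] .
  then have "subst_letter (Fin u) (Par i) \<in> set (subst_list w u)" by (simp only: subst_list_def set_map imageI)
  then show "l \<in> set (subst_list w u)" using i by simp
qed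

text \<open>The cut positions increase strictly with the length of \<open>u\<close>, so the length
  of the result determines that of \<open>u\<close>. The letter \<open>u ! i\<close> is then read
  off at an occurrence of \<open>Par i\<close>.\<close>

lemma subst_list_inj:
  assumes w: "w \<in> param_words \<Sigma> n" and u: "length u \<le> n" "length u' \<le> n" and eq: "subst_list w u = subst_list w u'"
  shows "u = u'"
proof -
  have "length (takeWhile (\<lambda>l. l \<noteq> Par (length u)) w) = length (takeWhile (\<lambda>l. l \<noteq> Par (length u')) w)"
    using arg_cong[OF eq, of length] by (simp add: subst_list_def)
  then have len: "length u = length u'"
    using length_takeWhile_Par_less[OF w _ u(1), of "length u'"]
      length_takeWhile_Par_less[OF w _ u(2), of "length u"]
    by linarith
  show ?thesis
  proof (rule nth_equalityI[OF len])
    fix i assume i: "i < length u"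
    have "Par i \<in> set (takeWhile (\<lambda>l. l \<noteq> Par (length u)) w)"
      using param_words_params[OF param_words_takeWhile[OF w u(1)] i] .
    moreover have "\<forall>l\<in>set (takeWhile (\<lambda>l. l \<noteq> Par (length u)) w).
        subst_letter (Fin u) l = subst_letter (Fin u') l"
      using eq unfolding subst_list_def len[symmetric] map_eq_conv .
    ultimately show "u ! i = u' ! i" by fastforce
  qed
qed

section \<open>The embedding\<close>

lemma length_inf_word_less:
  assumes "inf_word \<Sigma> E" "i < j" shows "length (E i) < length (E j)"
  using inf_word_extends[OF assms] by auto

lemma inf_word_params:
  assumes "inf_word \<Sigma> E" "i < j" shows "Par i \<in> set (E j)"
  using inf_word_extends[OF assms] by auto

lemma length_inf_word_less_iff:
  assumes "inf_word \<Sigma> E" shows "length (E i) < length (E j) \<longleftrightarrow> i < j"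
  using length_inf_word_less[OF assms, of i j] length_inf_word_less[OF assms, of j i]
  by (cases i j rule: linorder_cases) auto

lemma subst_inf_inj:
  assumes E: "inf_word \<Sigma> E" and eq: "subst_inf E u = subst_inf E u'"
  shows "u = u'"
proof -
  have "length (E (length u)) = length (E (length u'))"
    using arg_cong[OF eq, of length] by (simp add: subst_inf_def)
  then have len: "length u = length u'"
    using length_inf_word_less_iff[OF E] by (metis linorder_neqE_nat less_irrefl)
  show ?thesis
  proof (rule nth_equalityI[OF len])
    fix i assume i: "i < length u"
    have "\<forall>l\<in>set (E (length u)). subst_letter (Fin u) l = subst_letter (Fin u') l"
      using eq unfolding subst_inf_def len[symmetric] map_eq_conv .
    then show "u ! i = u' ! i" using inf_word_params[OF E i] by fastforce
  qed
qed

text \<open>The image of \<open>v\<close> carries \<open>v ! length u\<close> at the index where the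
  image of \<open>u\<close> ends. Before it, both images carry \<open>Par 0\<close> only at
  occurrences of some \<open>Par i\<close> with \<open>u ! i = v ! i = Par 0\<close>, and each such
  \<open>i < length u\<close> does occur.\<close>

lemma subst_inf_edge_up:
  assumes E: "inf_word \<Sigma> E"
  shows "G_edge_up (Fin (subst_inf E u)) (Fin (subst_inf E v)) \<longleftrightarrow> G_edge_up (Fin u) (Fin v)"
proof (cases "length u < length v")
  case False
  then show ?thesis by (simp add: G_edge_up_def subst_inf_def length_inf_word_less_iff[OF E])
next
  case True
  let ?e = "E (length u)"
  obtain b where b: "E (length v) = ?e @ Par (length u) # b" using inf_word_extends[OF E True] by blast
  have len: "length (subst_inf E u) = length ?e" "length (subst_inf E u) < length (subst_inf E v)" by (auto simp: subst_inf_def b)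
  have "subst_inf E v ! length (subst_inf E u) = v ! length u" by (simp add: subst_inf_def b nth_append)
  moreover have "(\<exists>j<length ?e. subst_inf E u ! j = Par 0 \<and> subst_inf E v ! j = Par 0) \<longleftrightarrow>
    (\<exists>i<length u. u ! i = Par 0 \<and> v ! i = Par 0)"
  proof
    assume "\<exists>j<length ?e. subst_inf E u ! j = Par 0 \<and> subst_inf E v ! j = Par 0"
    then obtain j where j: "j < length ?e"
      "subst_letter (Fin u) (?e ! j) = Par 0" "subst_letter (Fin v) (?e ! j) = Par 0"
      by (auto simp: subst_inf_def b nth_append)
    have "?e ! j \<in> letters \<Sigma> (length u)" using inf_wordD(1)[OF E] j(1) nth_mem by blast
    then obtain i where "?e ! j = Par i" "i < length u" using j(2) by (auto simp: letters_def)
    then show "\<exists>i<length u. u ! i = Par 0 \<and> v ! i = Par 0" using j by auto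
  next
    assume "\<exists>i<length u. u ! i = Par 0 \<and> v ! i = Par 0"
    then obtain i where i: "i < length u" "u ! i = Par 0" "v ! i = Par 0" by blast
    then obtain j where "j < length ?e" "?e ! j = Par i"
      using inf_word_params[OF E i(1)] by (auto simp: in_set_conv_nth)
    then show "\<exists>j<length ?e. subst_inf E u ! j = Par 0 \<and> subst_inf E v ! j = Par 0"
      using i by (intro exI[of _ j]) (simp add: subst_inf_def b nth_append)
  qed
  ultimately show ?thesis using True len unfolding G_edge_up_def by auto
qed

lemma G_verts_eq: "G_verts = Fin ` param_words {0} 1"
proof
  show "G_verts \<subseteq> Fin ` param_words {0} 1"
  proof
    fix U assume "U \<in> G_verts"
    then have "param_word {0} (enat 1) U" "wlength U \<noteq> \<infinity>" by (simp_all add: G_verts_def one_enat_def)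
    then show "U \<in> Fin ` param_words {0} 1" by (cases U) (auto simp: param_word_Fin_iff)
  qed
  show "Fin ` param_words {0} 1 \<subseteq> G_verts"
    using param_word_if_param_words[of _ "{0::nat}" 1] by (auto simp: G_verts_def one_enat_def)
qed

section \<open>Minimal envelopes\<close>

lemma param_words_snoc: "w \<in> param_words \<Sigma> n \<Longrightarrow> l \<in> letters \<Sigma> n \<Longrightarrow> w @ [l] \<in> param_words \<Sigma> n"
  by (cases n) fastforce+

text \<open>\<open>w\<close> is the word in which equal entries of \<open>cs\<close> receive equal parameters.\<close>

lemma first_occurrence_word:
  "\<exists>ds w. distinct ds \<and> set ds = set cs \<and> w \<in> param_words \<Sigma> (length ds) \<and> length w = length cs \<and>
    (\<forall>j<length cs. \<exists>i<length ds. w ! j = Par i \<and> ds ! i = cs ! j)"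
proof (induction cs rule: rev_induct)
  case Nil
  show ?case by (intro exI[of _ "[]"]) simp
next
  case (snoc c cs)
  then obtain ds w where IH: "distinct ds" "set ds = set cs" "w \<in> param_words \<Sigma> (length ds)" "length w = length cs"
    "\<forall>j<length cs. \<exists>i<length ds. w ! j = Par i \<and> ds ! i = cs ! j" by blast
  show ?case
  proof (cases "c \<in> set ds")
    case True
    then obtain i where i: "i < length ds" "ds ! i = c" by (auto simp: in_set_conv_nth)
    then have "w @ [Par i] \<in> param_words \<Sigma> (length ds)" by (intro param_words_snoc IH) (simp add: letters_def)
    moreover have "\<exists>i'<length ds. (w @ [Par i]) ! j = Par i' \<and> ds ! i' = (cs @ [c]) ! j"
      if "j < length (cs @ [c])" for j
      using that IH(4,5) i by (cases "j < length cs") (auto simp: nth_append)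
    ultimately show ?thesis
      using IH True by (intro exI[of _ ds] exI[of _ "w @ [Par i]"]) auto
  next
    case False
    have "w @ [Par (length ds)] \<in> param_words \<Sigma> (length (ds @ [c]))" using IH(3) by auto
    moreover have "\<exists>i'<length (ds @ [c]). (w @ [Par (length ds)]) ! j = Par i' \<and> (ds @ [c]) ! i' = (cs @ [c]) ! j"
      if "j < length (cs @ [c])" for j
    proof (cases "j < length cs")
      case True
      then obtain i where "i < length ds" "w ! j = Par i" "ds ! i = cs ! j" using IH(5) by blast
      then show ?thesis using True IH(4) by (intro exI[of _ i]) (simp add: nth_append)
    next
      case False
      then show ?thesis using that IH(4) by (intro exI[of _ "length ds"]) (simp add: nth_append)
    qed
    ultimately show ?thesis
      using IH False by (intro exI[of _ "ds @ [c]"] exI[of _ "w @ [Par (length ds)]"]) auto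
  qed
qed

text \<open>With a single parameter there is no order of first occurrences to respect, so any word
  over these letters is a \<open>0\<close>- or \<open>1\<close>-parameter word.\<close>

lemma substitutable_Fin:
  assumes "set u \<subseteq> letters \<Sigma> 1" "length u \<le> n"
  shows "Fin u \<in> substitutable \<Sigma> (enat n)"
proof -
  have "\<exists>k. u \<in> param_words \<Sigma> k"
  proof (cases "Par 0 \<in> set u")
    case True
    then obtain a b where ab: "u = a @ Par 0 # b" "Par 0 \<notin> set a" by (metis split_list_first)
    have "set a \<subseteq> letters \<Sigma> 1 - {Par 0}" "set b \<subseteq> letters \<Sigma> 1" using ab assms(1) by auto
    moreover have "letters \<Sigma> 1 - {Par 0} \<subseteq> letters \<Sigma> 0" by (auto simp: letters_def)
    ultimately have "a \<in> param_words \<Sigma> 0" "b \<in> lists (letters \<Sigma> (Suc 0))" by auto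
    then have "u \<in> param_words \<Sigma> (Suc 0)" using ab(1) by auto
    then show ?thesis by blast
  next
    case False
    then have "u \<in> param_words \<Sigma> 0" using assms(1) by (auto simp: letters_def)
    then show ?thesis by blast
  qed
  then show ?thesis using assms(2) param_word_if_param_words by (auto simp: substitutable_def)
qed

text \<open>The position \<open>j\<close> of the envelope gets a parameter that depends only on the column of the \<open>j\<close>-th
  letters of the words. The end of a word counts as a third symbol, so that truncation takes place
  where a new column appears.\<close>

lemma small_envelope:
  assumes X: "finite X" "X \<subseteq> param_words {0::nat} 1"
  shows "\<exists>n W. n \<le> 3 ^ card X \<and> envelope {0} (Fin ` X) (enat n) W"
proof -
  define M where "M = Max (insert 0 (length ` X))"
  have M: "length u \<le> M" if "u \<in> X" for u using that X(1) by (simp add: M_def)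
  define col where "col j = (\<lambda>u\<in>X. if j < length u then Some (u ! j) else None)" for j
  define cs where "cs = map col [0..<M]"
  obtain ds w where ds: "distinct ds" "set ds = set cs"
    and w: "w \<in> param_words {0::nat} (length ds)" "length w = M"
    and dw: "\<And>j. j < M \<Longrightarrow> \<exists>i<length ds. w ! j = Par i \<and> ds ! i = col j"
    using first_occurrence_word[of cs "{0::nat}"] by (auto simp: cs_def)
  let ?n = "length ds"
  have u_letters: "set u \<subseteq> letters {0} 1" if "u \<in> X" for u using X(2) that param_words_letters by blast
  have "?n \<le> 3 ^ card X"
  proof -
    have "col j \<in> (\<Pi>\<^sub>E u\<in>X. {None, Some (Sym 0), Some (Par 0)})" for j
    proof -
      have "u ! j \<in> {Sym 0, Par 0}" if "u \<in> X" "j < length u" for u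
        using u_letters[OF that(1)] nth_mem[OF that(2)] by (auto simp: letters_def)
      then show ?thesis by (auto simp: col_def)
    qed
    then have "set ds \<subseteq> (\<Pi>\<^sub>E u\<in>X. {None, Some (Sym 0), Some (Par 0)})"
      unfolding ds(2) cs_def set_map by (rule image_subsetI)
    then have "card (set ds) \<le> card (\<Pi>\<^sub>E u\<in>X. {None, Some (Sym (0::nat)), Some (Par 0)})"
      using X(1) by (intro card_mono finite_PiE) auto
    also have "\<dots> = 3 ^ card X" using X(1) by (simp add: card_PiE numeral_3_eq_3)
    finally show ?thesis using distinct_card[OF ds(1)] by simp
  qed
  moreover have "\<exists>u'\<in>substitutable {0} (enat ?n). Fin u = subst (Fin w) u'" if u: "u \<in> X" for u
  proof -
    let ?t = "take (length u) w"
    obtain m where m: "m \<le> ?n" "takeWhile (\<lambda>l. l \<noteq> Par m) w = ?t"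
    proof (cases "length u = M")
      case True
      then show ?thesis using param_words_takeWhile_id[OF w(1)] w(2) by (intro that[of ?n]) simp_all
    next
      case False
      then have lt: "length u < M" using M[OF u] by simp
      then obtain m where m: "m < ?n" "w ! length u = Par m" "ds ! m = col (length u)" using dw by blast
      have "w ! j \<noteq> Par m" if "j < length u" for j
      proof
        assume "w ! j = Par m"
        then have "col j = col (length u)" using dw[of j] that lt m(3) by auto
        then have "col j u = col (length u) u" by simp
        then show False using that u by (simp add: col_def)
      qed
      then have "takeWhile (\<lambda>l. l \<noteq> Par m) w = ?t"
        using m(2) by (intro takeWhile_eq_take_P_nth) auto
      then show ?thesis using m(1) by (intro that[of m]) simp_all
    qed
    have t: "?t \<in> param_words {0} m" using param_words_takeWhile[OF w(1) m(1)] m(2) by simp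
    \<comment> \<open>The \<open>i\<close>-th letter is the entry of \<open>u\<close> in the
      \<open>i\<close>-th distinct column.\<close>
    define u' where "u' = map (\<lambda>i. the ((ds ! i) u)) [0..<m]"
    have eq: "map (subst_letter (Fin u')) ?t = u"
    proof (rule nth_equalityI)
      show "length (map (subst_letter (Fin u')) ?t) = length u" using M[OF u] w(2) by simp
      fix j assume "j < length (map (subst_letter (Fin u')) ?t)"
      then have j: "j < length u" "j < length ?t" by simp_all
      then obtain i where i: "w ! j = Par i" "ds ! i = col j" using dw[of j] M[OF u] by fastforce
      have "?t ! j \<in> letters {0} m" using param_words_letters[OF t] nth_mem[OF j(2)] by blast
      then have "i < m" using i j by (auto simp: letters_def)
      then show "map (subst_letter (Fin u')) ?t ! j = u ! j"
        using i j u by (simp add: u'_def col_def)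
    qed
    have len: "length u' = m" by (simp add: u'_def)
    have subst_list: "subst_list w u' = u" using eq m(2) by (simp add: subst_list_def len)
    have "set u' \<subseteq> letters {0} 1"
      using subst_list_letters[OF w(1), of u'] subst_list len m(1) u_letters[OF u] by auto
    then have "Fin u' \<in> substitutable {0} (enat ?n)"
      using substitutable_Fin len m(1) by blast
    then show ?thesis using subst_list by (intro bexI[of _ "Fin u'"]) (simp_all add: subst_Fin)
  qed
  ultimately show ?thesis
    using param_word_if_param_words[OF w(1)] by (intro exI[of _ ?n] exI[of _ "Fin w"]) (auto simp: envelope_def)
qed

text \<open>A finite set containing all words that can occur in the type of a vertex set with an
  \<open>m\<close>-parameter minimal envelope.\<close>

definition short_words :: "nat \<Rightarrow> nat letter list set" where
  "short_words m = {u. set u \<subseteq> letters {0} 1 \<and> length u \<le> m}"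

lemma finite_short_words: "finite (short_words m)"
  unfolding short_words_def by (intro finite_lists_length_le finite_letters) simp

lemma substitutable_enat:
  assumes "U \<in> substitutable \<Sigma> (enat n)"
  shows "\<exists>u. U = Fin u \<and> length u \<le> n"
  using assms by (cases U) (auto simp: substitutable_def)

text \<open>Otherwise \<open>W\<close> could be cut before its last parameter and still be an
  envelope. Hence the type determines the number of parameters, as the largest length in it.\<close>

lemma minimal_envelope_full_length:
  assumes min: "minimal_envelope \<Sigma> S (enat m) W" and S: "S \<noteq> {}"
  shows "\<exists>u. length u = m \<and> Fin u \<in> substitutable \<Sigma> (enat m) \<and> subst W (Fin u) \<in> S"
proof (rule ccontr)
  assume neg: "\<not> ?thesis"
  have W: "param_word \<Sigma> (enat m) W" and env: "\<forall>U\<in>S. \<exists>U'\<in>substitutable \<Sigma> (enat m). U = subst W U'"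
    using min by (auto simp: minimal_envelope_def envelope_def)
  have *: "\<exists>u. Fin u \<in> substitutable \<Sigma> (enat m) \<and> U = subst W (Fin u) \<and> length u < m" if U: "U \<in> S" for U
  proof -
    obtain U' where U': "U' \<in> substitutable \<Sigma> (enat m)" "U = subst W U'" using env U by blast
    then obtain u where u: "U' = Fin u" "length u \<le> m" using substitutable_enat by blast
    have "length u \<noteq> m" using neg U' u(1) U by blast
    then show ?thesis using u U' by auto
  qed
  then obtain p where m: "m = Suc p" using S by (metis ex_in_conv not_less0 not0_implies_Suc)
  let ?g = "map (wnth W) [0..<first_occ p W]"
  note W' = W[unfolded m]
  have "\<exists>U'\<in>substitutable \<Sigma> (enat p). U = subst (Fin ?g) U'" if "U \<in> S" for U
  proof -
    obtain u where u: "Fin u \<in> substitutable \<Sigma> (enat m)" "U = subst W (Fin u)" "length u < m"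
      using *[OF \<open>U \<in> S\<close>] by blast
    then have "U = subst (Fin ?g) (Fin u)" using truncate_param_word(2)[OF W', of u] m by simp
    moreover have "Fin u \<in> substitutable \<Sigma> (enat p)" using u m by (auto simp: substitutable_def)
    ultimately show ?thesis by blast
  qed
  then have "envelope \<Sigma> S (enat p) (Fin ?g)"
    using truncate_param_word(1)[OF W'] by (simp add: envelope_def)
  moreover have "enat p < enat m" using m by simp
  ultimately show False using min unfolding minimal_envelope_def by blast
qed

lemma minimal_envelope_type:
  assumes min: "minimal_envelope {0} S (enat m) W" and S: "S \<subseteq> G_verts" "S \<noteq> {}"
  obtains w T where "w \<in> param_words {0} m" "T \<subseteq> short_words m" "\<exists>u\<in>T. length u = m"
    "envelope_type {0} (enat m) W S = Fin ` T" "S = Fin ` subst_list w ` T"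
proof -
  have W: "param_word {0} (enat m) W" and env: "\<forall>U\<in>S. \<exists>U'\<in>substitutable {0} (enat m). U = subst W U'"
    using min by (auto simp: minimal_envelope_def envelope_def)
  obtain u where u: "length u = m" "Fin u \<in> substitutable {0} (enat m)" "subst W (Fin u) \<in> S"
    using minimal_envelope_full_length[OF min S(2)] by blast
  \<comment> \<open>Substituting a \<open>u\<close> of full length truncates nothing, so an infinite
    \<open>W\<close> would produce an infinite element of \<open>S\<close>.\<close>
  have "\<exists>w. W = Fin w"
  proof (cases W)
    case (Inf h)
    have "\<not> occurs m W"
      using W by (auto simp: occurs_def param_word_def)
    then have "subst W (Fin u) = Inf (\<lambda>j. subst_letter (Fin u) (h j))"
      using u(1) Inf by (simp add: subst_def subst_length_def build_word_def)
    then show ?thesis using u(3) S(1) by (auto simp: G_verts_eq)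
  qed blast
  then obtain w where w: "W = Fin w" by blast
  then have w_param_words: "w \<in> param_words {0} m" using W by (simp add: param_word_Fin_iff)
  have inj: "inj_on (subst W) (substitutable {0} (enat m))"
  proof (rule inj_onI)
    fix U V assume UV: "U \<in> substitutable {0} (enat m)" "V \<in> substitutable {0} (enat m)" "subst W U = subst W V"
    obtain u v where "U = Fin u" "length u \<le> m" "V = Fin v" "length v \<le> m"
      using substitutable_enat[OF UV(1)] substitutable_enat[OF UV(2)] by blast
    then show "U = V" using UV(3) subst_list_inj[OF w_param_words] by (simp add: w subst_Fin)
  qed
  define T0 where "T0 = {U \<in> substitutable {0} (enat m). subst W U \<in> S}"
  have T0: "T0 \<subseteq> substitutable {0} (enat m)" "subst W ` T0 = S"
    using env by (auto simp: T0_def)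
  \<comment> \<open>By injectivity the full preimage \<open>T0\<close> is the only set of
    substitutable words with image \<open>S\<close>, so the definite description is well
    defined.\<close>
  have type: "envelope_type {0} (enat m) W S = T0"
    unfolding envelope_type_def
  proof (rule the_equality)
    show "T0 \<subseteq> substitutable {0} (enat m) \<and> subst W ` T0 = S" using T0 by blast
    fix T assume "T \<subseteq> substitutable {0} (enat m) \<and> subst W ` T = S"
    then show "T = T0" using inj_on_image_eq_iff[OF inj, of T T0] T0 by simp
  qed
  define T where "T = {v. Fin v \<in> T0}"
  have T0_T: "T0 = Fin ` T"
    unfolding T_def using T0(1) substitutable_enat by fastforce
  show thesis
  proof
    show "w \<in> param_words {0} m" by fact
    show "T \<subseteq> short_words m"
    proof
      fix v assume "v \<in> T"
      then have "Fin v \<in> T0" by (simp add: T_def)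
      then have v: "length v \<le> m" "Fin (subst_list w v) \<in> S"
        using substitutable_enat[of "Fin v" "{0}" m] by (auto simp: T0_def w subst_Fin)
      then have "subst_list w v \<in> param_words {0} 1" using S(1) by (auto simp: G_verts_eq)
      then show "v \<in> short_words m"
        using subst_list_letters[OF w_param_words v(1)] param_words_letters v(1) by (fastforce simp: short_words_def)
    qed
    show "\<exists>u\<in>T. length u = m" using u by (auto simp: T_def T0_def)
    show "envelope_type {0} (enat m) W S = Fin ` T" using type T0_T by simp
    show "S = Fin ` subst_list w ` T" using T0(2) by (simp add: T0_T w image_image subst_Fin)
  qed
qed

text \<open>Whichever minimal envelope the choice operator selects, it has at most as many
  parameters as the small envelope and is covered by \<open>minimal_envelope_type\<close>.\<close>

lemma embedding_type_cases:
  assumes S: "finite S" "S \<subseteq> G_verts" "S \<noteq> {}"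
  obtains m w T where "m \<le> 3 ^ card S" "w \<in> param_words {0} m" "T \<subseteq> short_words m" "\<exists>u\<in>T. length u = m"
    "embedding_type {0} S = Fin ` T" "S = Fin ` subst_list w ` T"
proof -
  define X where "X = {u. Fin u \<in> S}"
  have SX: "S = Fin ` X" using S(2) by (auto simp: X_def G_verts_eq)
  have inj: "inj_on Fin X" by (simp add: inj_on_def)
  have X: "finite X" "X \<subseteq> param_words {0} 1" "card X = card S"
    using S SX finite_imageD[OF _ inj] card_image[OF inj] by (auto simp: G_verts_eq)
  obtain n0 W0 where n0: "n0 \<le> 3 ^ card S" "envelope {0} S (enat n0) W0"
    using small_envelope[OF X(1,2)] X(3) SX by auto
  define n where "n = (LEAST n. \<exists>W. envelope {0} S n W)"
  have "\<exists>W. envelope {0} S n W" unfolding n_def by (rule LeastI_ex) (use n0 in blast)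
  moreover have "\<not> (\<exists>W. envelope {0} S n' W)" if "n' < n" for n'
    using not_less_Least[OF that[unfolded n_def]] .
  ultimately have "\<exists>T n W. minimal_envelope {0} S n W \<and> T = envelope_type {0} n W S"
    unfolding minimal_envelope_def by blast
  then have "\<exists>n W. minimal_envelope {0} S n W \<and> embedding_type {0} S = envelope_type {0} n W S"
    unfolding embedding_type_def by (rule someI_ex)
  then obtain n W where nW: "minimal_envelope {0} S n W" "embedding_type {0} S = envelope_type {0} n W S"
    by blast
  then have "n \<le> enat n0" using n0(2) by (meson minimal_envelope_def not_le_imp_less)
  then obtain m where m: "n = enat m" "m \<le> n0" by (cases n) auto
  obtain w T where "w \<in> param_words {0} m" "T \<subseteq> short_words m" "\<exists>u\<in>T. length u = m"
    "envelope_type {0} (enat m) W S = Fin ` T" "S = Fin ` subst_list w ` T"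
    using minimal_envelope_type[OF nW(1)[unfolded m(1)] S(2,3)] .
  then show thesis using that[of m w T] m n0(1) nW(2) by simp
qed

section \<open>The theorem\<close>

theorem theorem4p5:
  fixes k :: nat and \<chi> :: "nat pword set \<Rightarrow> 'c"
  assumes "k \<ge> 1"
    and "finite (\<chi> ` nsets G_verts k)"
  shows "\<exists>f. graph_embedding G_verts G_adj G_verts G_adj f \<and>
    (\<forall>A \<in> nsets (f ` G_verts) k. \<forall>A' \<in> nsets (f ` G_verts) k.
       embedding_type {0} {U \<in> G_verts. f U \<in> A} = embedding_type {0} {U \<in> G_verts. f U \<in> A'}
       \<longrightarrow> \<chi> A = \<chi> A')"
proof -
  \<comment> \<open>The colour of \<open>q\<close> is the whole function
    \<open>T \<mapsto> \<chi>(q(T))\<close>. The default \<open>undefined\<close> where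
    \<open>q(T)\<close> is not a \<open>k\<close>-element set of vertices keeps the palette
    finite.\<close>
  define color where "color m q = (\<lambda>T\<in>Pow (short_words m).
    if Fin ` subst_list q ` T \<in> nsets G_verts k then \<chi> (Fin ` subst_list q ` T) else undefined)" for m and q :: "nat letter list"
  have "finite (color m ` param_words {0} m)" for m
  proof (rule finite_subset)
    show "color m ` param_words {0} m \<subseteq> (\<Pi>\<^sub>E T\<in>Pow (short_words m). insert undefined (\<chi> ` nsets G_verts k))"
      unfolding color_def by (rule image_subsetI) (simp add: restrict_PiE_iff)
    show "finite (\<Pi>\<^sub>E T\<in>Pow (short_words m). insert undefined (\<chi> ` nsets G_verts k))"
      using finite_short_words assms(2) by (intro finite_PiE) simp_all
  qed
  then obtain E where E: "inf_word {0} E"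
    and const: "\<forall>m<Suc (3 ^ k). \<exists>c0. \<forall>w\<in>param_words {0} m. color m (subst_inf E w) = c0"
    using simultaneous_parameter_word_ramsey[of "{0::nat}" color "Suc (3 ^ k)"] by auto
  define f where "f U = (case U of Fin u \<Rightarrow> Fin (subst_inf E u) | Inf h \<Rightarrow> Inf h)" for U
  have f_Fin: "f (Fin u) = Fin (subst_inf E u)" for u by (simp add: f_def)
  have f_verts: "f U \<in> G_verts" if "U \<in> G_verts" for U
    using that subst_inf_param_words[OF E, of _ 1] unfolding G_verts_eq by (auto simp: f_Fin simp del: param_words.simps One_nat_def)
  have "inj_on f G_verts"
    using subst_inf_inj[OF E] by (auto simp: inj_on_def G_verts_eq f_Fin)
  moreover have "G_adj U V \<longleftrightarrow> G_adj (f U) (f V)" if UV: "U \<in> G_verts" "V \<in> G_verts" for U V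
  proof -
    obtain u v where "U = Fin u" "V = Fin v" using UV by (auto simp: G_verts_eq)
    then show ?thesis
      using UV f_verts[OF UV(1)] f_verts[OF UV(2)] by (simp add: G_adj_def f_Fin subst_inf_edge_up[OF E])
  qed
  ultimately have "graph_embedding G_verts G_adj G_verts G_adj f"
    using f_verts by (auto simp: graph_embedding_def)
  moreover have "\<chi> A = \<chi> A'"
    if A: "A \<in> nsets (f ` G_verts) k" and A': "A' \<in> nsets (f ` G_verts) k"
      and eq: "embedding_type {0} {U \<in> G_verts. f U \<in> A} = embedding_type {0} {U \<in> G_verts. f U \<in> A'}"
    for A A'
  proof -
    \<comment> \<open>The preimage of \<open>B\<close> is \<open>w(T)\<close>, so \<open>B\<close>
      is the image of \<open>T\<close> under the word \<open>subst_inf E w\<close>, and the colour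
      of that word records \<chi> of \<open>B\<close>.\<close>
    have type: "\<exists>m w T. m \<le> 3 ^ k \<and> w \<in> param_words {0} m \<and> T \<subseteq> short_words m \<and> (\<exists>u\<in>T. length u = m) \<and>
      embedding_type {0} {U \<in> G_verts. f U \<in> B} = Fin ` T \<and> color m (subst_inf E w) T = \<chi> B"
      if B: "B \<in> nsets (f ` G_verts) k" for B
    proof -
      define S where "S = {U \<in> G_verts. f U \<in> B}"
      have BS: "B = f ` S" using B by (auto simp: S_def nsets_def)
      have inj: "inj_on f S" using \<open>inj_on f G_verts\<close> by (rule inj_on_subset) (auto simp: S_def)
      have "finite (f ` S)" "card (f ` S) = k" using B by (simp_all add: BS[symmetric] nsets_def)
      then have S: "finite S" "card S = k" "S \<subseteq> G_verts"
        using inj by (simp_all add: finite_image_iff card_image S_def)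
      then have "S \<noteq> {}" using assms(1) by auto
      then obtain m w T where *: "m \<le> 3 ^ card S" "w \<in> param_words {0} m" "T \<subseteq> short_words m"
        "\<exists>u\<in>T. length u = m" "embedding_type {0} S = Fin ` T" "S = Fin ` subst_list w ` T"
        using embedding_type_cases[OF S(1,3)] by blast
      have "B = (\<lambda>u. Fin (subst_inf E (subst_list w u))) ` T" by (simp add: BS *(6) image_image f_Fin)
      also have "\<dots> = (\<lambda>u. Fin (subst_list (subst_inf E w) u)) ` T"
        using *(3) by (intro image_cong refl) (auto simp: short_words_def subst_inf_subst_list[OF E *(2)])
      finally have "Fin ` subst_list (subst_inf E w) ` T = B" by (simp add: image_image)
      moreover have "B \<in> nsets G_verts k" using B f_verts by (auto simp: nsets_def)
      ultimately have "color m (subst_inf E w) T = \<chi> B" using *(3) by (simp add: color_def)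
      then show ?thesis using * S(2) unfolding S_def by blast
    qed
    obtain m w T where 1: "m \<le> 3 ^ k" "w \<in> param_words {0} m" "T \<subseteq> short_words m" "\<exists>u\<in>T. length u = m"
      "embedding_type {0} {U \<in> G_verts. f U \<in> A} = Fin ` T" "color m (subst_inf E w) T = \<chi> A"
      using type[OF A] by blast
    obtain m' w' T' where 2: "m' \<le> 3 ^ k" "w' \<in> param_words {0} m'" "T' \<subseteq> short_words m'" "\<exists>u\<in>T'. length u = m'"
      "embedding_type {0} {U \<in> G_verts. f U \<in> A'} = Fin ` T'" "color m' (subst_inf E w') T' = \<chi> A'"
      using type[OF A'] by blast
    have "Fin ` T = Fin ` T'" using eq 1(5) 2(5) by simp
    then have "T = T'" by (simp add: inj_image_eq_iff inj_on_def)
    \<comment> \<open>Both numbers are the largest length of a word in the common type.\<close>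
    have "m = m'"
    proof (rule antisym)
      show "m \<le> m'" using 1(4) 2(3) \<open>T = T'\<close> by (auto simp: short_words_def)
      show "m' \<le> m" using 2(4) 1(3) \<open>T = T'\<close> by (auto simp: short_words_def)
    qed
    obtain c0 where c0: "\<forall>w\<in>param_words {0} m. color m (subst_inf E w) = c0"
      using const 1(1) by (auto simp: less_Suc_eq_le)
    have "w' \<in> param_words {0} m" using 2(2) \<open>m = m'\<close> by simp
    then have "color m (subst_inf E w) = color m (subst_inf E w')" using c0 1(2) by simp
    then show ?thesis using 1(6) 2(6) \<open>T = T'\<close> \<open>m = m'\<close> by simp
  qed
  ultimately show ?thesis by blast
qed

end
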